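(* There exist functions $\omega_l,\omega_u:\mathbb{N}\to\mathbb{R}$ with $\omega_l(r)=o(r)$ and $\omega_u(r)=o(r)$ as $r\to\infty$ such that the following holds. Let $G_n$ be a random $r$-regular graph on $n$ vertices and let $d=\mathrm{diam}(G_n)$. Assume $r\ge 3$, $n>\max\{\lceil r^r\rceil,\lceil r^2J/h\rceil\}$, $h>0$ and $J\ge\max\{1,\lceil h/i_e(G_n)\rceil\}$. Put $$\Gamma_l=J\Big(\frac r2-\omega_l(r)\Big)n,\qquad \Gamma_u=J\big(r f(r,\lambda)+\omega_u(r)\big)n .$$ Then, with high probability, the stability level of $\mathbf{-1}$ satisfies $$\Gamma_l\le V_{\mathbf{-1}}\le\Gamma_u .$$
   Context: Graph. For $r\in\mathbb{N}$ and $n>r$ with $nr$ even, a random $r$-regular graph $G_n=(V_n,E_n)$, $V_n=\{1,\dots,n\}$, is chosen uniformly among all simple $r$-regular graphs on $V_n$. $d(x,y)$ is the graph distance and $\mathrm{diam}(G_n)=\max_{x,y}d(x,y)$. For $A\subset V_n$, $\partial_eA=\{(x,y)\in E_n: x\in A,\ y\notin A\}$; the Cheeger constant is $i_e(G_n)=\min_{A\subset V_n,\,1\le|A|\le n/2}|\partial_eA|/|A|$. The condition $J\ge\max\{1,\lceil h/i_e(G_n)\rceil\}$ includes $i_e(G_n)>0$, i.e. $G_n$ is connected. "With high probability" (w.h.p.): the probability over the choice of $G_n$ that the conclusion holds whenever the parameter conditions hold tends to $1$ as $n\to\infty$ (along $nr$ even). Interaction. One of two choices is made: $\mathcal{J}(i)=Jr^{1-i}$,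 or $\mathcal{J}(i)=Ji^{-\lambda}$, with constants $J>0$, $\lambda>2$. With $\zeta(\lambda)=\sum_{k\ge1}k^{-\lambda}$ and $d=\mathrm{diam}(G_n)$, set $f(r,\lambda)=r$ if $\mathcal{J}(i)=Jr^{1-i}$; $f(r,\lambda)=r-2$ if $\mathcal{J}(i)=Ji^{-\lambda}$ and $\lambda\ge d$; $f(r,\lambda)=\zeta(\lambda)(r-1)^d$ if $\mathcal{J}(i)=Ji^{-\lambda}$ and $\lambda<d$. Model. $\mathcal{X}=\{-1,+1\}^{V_n}$ and $H(\sigma)=-\sum_{\{x,y\}\subset V_n,\,x\ne y}\mathcal{J}(d(x,y))\sigma_x\sigma_y-h\sum_{x\in V_n}\sigma_x$, each unordered pair counted once. $\mathbf{-1}$ is the configuration with all spins $-1$. Stability level. A path is a finite sequence of configurations in which consecutive ones differ by a single spin flip. $\Phi(\sigma,\eta)=\min_{\omega:\sigma\to\eta}\max_{\zeta\in\omega}H(\zeta)$ over paths $\omega$ from $\sigma$ to $\eta$. Let $\mathcal{I}_\sigma=\{\eta: H(\eta)<H(\sigma)\}$; the stability level is $V_\sigma=\min_{\eta\in\mathcal{I}_\sigma}\Phi(\sigma,\eta)-H(\sigma)$ ($=\infty$ if $\mathcal{I}_\sigma=\emptyset$). *)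

theory Defs
  imports "HOL-Probability.Probability" "HOL-Library.Landau_Symbols"
begin

section \<open>Regular graphs\<close>

text \<open>A simple graph on \<open>{1..n}\<close> is given by its symmetric, irreflexive adjacency relation, so
  every edge occurs in both orientations.\<close>

definition regular_graphs :: "nat \<Rightarrow> nat \<Rightarrow> (nat \<times> nat) set set" where
  "regular_graphs r n =
     {E. E \<subseteq> {1..n} \<times> {1..n} \<and> irrefl E \<and> sym E \<and> (\<forall>x\<in>{1..n}. card (E `` {x}) = r)}"

text \<open>The random regular graph; meaningful for \<open>n > r\<close> and \<open>n * r\<close> even, when
  \<open>regular_graphs r n\<close> is finite and nonempty.\<close>

definition random_regular_graph :: "nat \<Rightarrow> nat \<Rightarrow> (nat \<times> nat) set pmf" where
  "random_regular_graph r n = pmf_of_set (regular_graphs r n)"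

text \<open>\<open>E ^^ k\<close> relates the endpoints of walks of length \<open>k\<close>. The value of the distance is
  arbitrary if \<open>x\<close> and \<open>y\<close> are not connected.\<close>

definition graph_dist :: "(nat \<times> nat) set \<Rightarrow> nat \<Rightarrow> nat \<Rightarrow> nat" where
  "graph_dist E x y = (LEAST k. (x, y) \<in> E ^^ k)"

definition graph_diam :: "nat \<Rightarrow> (nat \<times> nat) set \<Rightarrow> nat" where
  "graph_diam n E = Max {graph_dist E x y | x y. x \<in> {1..n} \<and> y \<in> {1..n}}"

definition edge_boundary :: "(nat \<times> nat) set \<Rightarrow> nat set \<Rightarrow> (nat \<times> nat) set" where
  "edge_boundary E A = {(x, y). (x, y) \<in> E \<and> x \<in> A \<and> y \<notin> A}"

definition cheeger :: "nat \<Rightarrow> (nat \<times> nat) set \<Rightarrow> real" where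
  "cheeger n E =
     Min {real (card (edge_boundary E A)) / real (card A) | A.
            A \<subseteq> {1..n} \<and> 1 \<le> card A \<and> real (card A) \<le> real n / 2}"

section \<open>Interaction and Hamiltonian\<close>

datatype decay = Exponential | Power_Law real

fun coupling :: "decay \<Rightarrow> real \<Rightarrow> nat \<Rightarrow> nat \<Rightarrow> real" where
  "coupling Exponential J r i = J * real r powr (1 - real i)"
| "coupling (Power_Law l) J r i = J * real i powr (- l)"

definition zeta_real :: "real \<Rightarrow> real" where
  "zeta_real l = (\<Sum>k. real (Suc k) powr (- l))"

fun upper_factor :: "decay \<Rightarrow> nat \<Rightarrow> nat \<Rightarrow> real" where
  "upper_factor Exponential r d = real r"
| "upper_factor (Power_Law l) r d =
     (if l \<ge> real d then real r - 2 else zeta_real l * (real r - 1) ^ d)"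

text \<open>Spin configurations on \<open>{1..n}\<close> are extensional functions, so there are exactly \<open>2 ^ n\<close> of
  them.\<close>

definition configs :: "nat \<Rightarrow> (nat \<Rightarrow> real) set" where
  "configs n = {1..n} \<rightarrow>\<^sub>E {-1, 1}"

definition all_minus :: "nat \<Rightarrow> nat \<Rightarrow> real" where
  "all_minus n = (\<lambda>x\<in>{1..n}. -1)"

text \<open>The unordered pair \<open>{x, y}\<close> is represented by the ordered pair with \<open>x < y\<close>.\<close>

definition hamiltonian ::
  "nat \<Rightarrow> (nat \<times> nat) set \<Rightarrow> (nat \<Rightarrow> real) \<Rightarrow> real \<Rightarrow> (nat \<Rightarrow> real) \<Rightarrow> real" where
  "hamiltonian n E K h \<sigma> =
     - (\<Sum>(x, y)\<in>{(x, y). x \<in> {1..n} \<and> y \<in> {1..n} \<and> x < y}.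
          K (graph_dist E x y) * \<sigma> x * \<sigma> y)
     - h * (\<Sum>x\<in>{1..n}. \<sigma> x)"

section \<open>Stability level\<close>

definition spin_path ::
  "nat \<Rightarrow> (nat \<Rightarrow> real) \<Rightarrow> (nat \<Rightarrow> real) \<Rightarrow> (nat \<Rightarrow> real) list \<Rightarrow> bool" where
  "spin_path n \<sigma> \<eta> \<omega> \<longleftrightarrow>
     \<omega> \<noteq> [] \<and> hd \<omega> = \<sigma> \<and> last \<omega> = \<eta> \<and> set \<omega> \<subseteq> configs n \<and>
     successively (\<lambda>\<xi> \<xi>'. \<exists>x\<in>{1..n}. \<xi>' = \<xi>(x := - \<xi> x)) \<omega>"

text \<open>There are infinitely many paths, but only finitely many maximal energies along them, because
  \<open>configs n\<close> is finite; so the outer \<open>Min\<close> is a genuine minimum.\<close>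

definition communication_height ::
  "nat \<Rightarrow> ((nat \<Rightarrow> real) \<Rightarrow> real) \<Rightarrow> (nat \<Rightarrow> real) \<Rightarrow> (nat \<Rightarrow> real) \<Rightarrow> real" where
  "communication_height n H \<sigma> \<eta> = Min {Max (H ` set \<omega>) | \<omega>. spin_path n \<sigma> \<eta> \<omega>}"

text \<open>The infimum is over a finite set and equals \<open>\<infinity>\<close> if that set is empty.\<close>

definition stability_level ::
  "nat \<Rightarrow> ((nat \<Rightarrow> real) \<Rightarrow> real) \<Rightarrow> (nat \<Rightarrow> real) \<Rightarrow> ereal" where
  "stability_level n H \<sigma> =
     (INF \<eta>\<in>{\<eta> \<in> configs n. H \<eta> < H \<sigma>}. ereal (communication_height n H \<sigma> \<eta>)) - ereal (H \<sigma>)"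

text \<open>The parameter conditions. Positivity of the Cheeger constant has to be required separately
  because \<open>h / 0 = 0\<close>.\<close>

definition admissible :: "nat \<Rightarrow> nat \<Rightarrow> (nat \<times> nat) set \<Rightarrow> real \<Rightarrow> real \<Rightarrow> bool" where
  "admissible r n E J h \<longleftrightarrow>
     int n > max \<lceil>real r ^ r\<rceil> \<lceil>(real r)\<^sup>2 * J / h\<rceil> \<and>
     cheeger n E > 0 \<and> J \<ge> max 1 (of_int \<lceil>h / cheeger n E\<rceil>)"

end

theory Submission
  imports Defs "HOL-Real_Asymp.Real_Asymp"
begin

text \<open>If \<open>A\<close> is the set of plus spins of \<open>\<sigma>\<close>, then \<open>H \<sigma> - H (-1)\<close> is twice the weight of the
  cut at \<open>A\<close> minus \<open>2 * h * card A\<close>. Because \<open>h \<le> J * i\<^sub>e\<close>, the edges of the cut alone pay for the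
  field as long as \<open>card A \<le> n / 2\<close>, so every path to a lower energy passes through
  \<open>card A = n div 2\<close>, and there all cut pairs at distance at least 2 count as profit.

  For the power law this profit is superlinear in \<open>n\<close> on every admissible graph: the Cheeger constant
  is at least \<open>h / J\<close>, which does not depend on \<open>n\<close>, so the diameter is logarithmic. For the exponential
  decay, pairs at distance 2 suffice. With high probability almost every vertex has close to \<open>r / 2\<close>
  neighbours on either side of any bisection, uniformly over bisections, which gives about \<open>r\<^sup>2 n / 4\<close>
  cut paths of length 2, and only boundedly many triangles and 4-cycles are expected. The probability
  estimates rest on a switching argument in the uniform model: a fixed set of \<open>m\<close> edges occurs with
  probability at most \<open>q ^ m\<close>, where \<open>q\<close> is close to \<open>r / n\<close> as long as \<open>m\<close> is small compared with
  \<open>r * n\<close>.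

  The upper bounds are those of the geometric and the zeta series, since at most
  \<open>r * (r - 1) ^ (i - 1)\<close> vertices lie at distance \<open>i\<close>; the case \<open>\<lambda> \<ge> d\<close> does not occur for large \<open>n\<close>.\<close>

section \<open>Switchings and edge counts\<close>

lemma finite_regular_graphs: "finite (regular_graphs r n)"
  by (rule finite_subset[of _ "Pow ({1..n} \<times> {1..n})"]) (auto simp: regular_graphs_def)

lemma regular_graphsD:
  assumes "E \<in> regular_graphs r n"
  shows "E \<subseteq> {1..n} \<times> {1..n}" "finite E" "sym E" "irrefl E"
    "\<And>x. x \<in> {1..n} \<Longrightarrow> card (E `` {x}) = r" "\<And>x. finite (E `` {x})"
    "\<And>x. card (E `` {x}) \<le> r"
proof -
  show *: "E \<subseteq> {1..n} \<times> {1..n}" "sym E" "irrefl E"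
    and r: "\<And>x. x \<in> {1..n} \<Longrightarrow> card (E `` {x}) = r"
    using assms by (auto simp: regular_graphs_def)
  show "finite E" using *(1) by (rule finite_subset) auto
  then show "\<And>x. finite (E `` {x})" by (rule finite_Image)
  show "card (E `` {x}) \<le> r" for x
  proof (cases "x \<in> {1..n}")
    case False
    then have "E `` {x} = {}" using *(1) by auto
    then show ?thesis by simp
  qed (simp add: r)
qed

lemma card_edges_from:
  assumes "E \<in> regular_graphs r n" "finite X"
  shows "card {(u, v) \<in> E. u \<in> X} \<le> card X * r"
proof -
  note E = regular_graphsD[OF assms(1)]
  have "{(u, v) \<in> E. u \<in> X} = Sigma X (\<lambda>u. E `` {u})" by auto
  then have "card {(u, v) \<in> E. u \<in> X} = (\<Sum>u\<in>X. card (E `` {u}))"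
    using E(6) assms(2) by (simp add: card_SigmaI)
  also have "\<dots> \<le> (\<Sum>u\<in>X. r)" by (intro sum_mono E(7))
  finally show ?thesis by simp
qed

lemma card_edges_to:
  assumes "E \<in> regular_graphs r n" "finite X"
  shows "card {(u, v) \<in> E. v \<in> X} \<le> card X * r"
proof -
  have "{(u, v) \<in> E. v \<in> X} = {(u, v) \<in> E. u \<in> X}\<inverse>"
    using regular_graphsD(3)[OF assms(1)] by (auto simp: sym_def)
  then show ?thesis
    using card_edges_from[OF assms] by simp
qed

lemma card_edges:
  assumes "E \<in> regular_graphs r n"
  shows "card E = n * r"
proof -
  note E = regular_graphsD[OF assms]
  have "E = Sigma {1..n} (\<lambda>u. E `` {u})" using E(1) by auto
  then have "card E = card (Sigma {1..n} (\<lambda>u. E `` {u}))" by simp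
  also have "\<dots> = (\<Sum>u\<in>{1..n}. card (E `` {u}))"
    using E(6) by (simp add: card_SigmaI)
  finally show ?thesis using E(5) by simp
qed

section \<open>Edge switchings and the frequency of a fixed edge set\<close>

definition switch :: "nat \<Rightarrow> nat \<Rightarrow> nat \<Rightarrow> nat \<Rightarrow> (nat \<times> nat) set \<Rightarrow> (nat \<times> nat) set" where
  "switch x y u v E =
     E - {(x, y), (y, x), (u, v), (v, u)} \<union> {(x, u), (u, x), (y, v), (v, y)}"

text \<open>Each of \<open>x\<close>, \<open>y\<close>, \<open>u\<close>, \<open>v\<close> trades
  exactly one neighbour for another. The conditions on \<open>u\<close> and \<open>v\<close> say
  that the new edges are neither loops nor present already, and with symmetry they force the four
  vertices to be distinct.\<close>

lemma switch_regular:
  assumes E: "E \<in> regular_graphs r n" and xy: "(x, y) \<in> E" and uv: "(u, v) \<in> E"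
    and u: "u \<notin> insert x (E `` {x})" and v: "v \<notin> insert y (E `` {y})"
  shows "switch x y u v E \<in> regular_graphs r n"
proof -
  note D = regular_graphsD[OF E]
  have sym: "(b, a) \<in> E" if "(a, b) \<in> E" for a b using D(3) that by (auto simp: sym_def)
  have irr: "(a, a) \<notin> E" for a using D(4) by (auto simp: irrefl_def)
  have dist: "x \<noteq> y" "u \<noteq> v" "u \<noteq> x" "u \<noteq> y" "v \<noteq> x" "v \<noteq> y"
    using xy uv u v irr sym by auto
  have V: "x \<in> {1..n}" "y \<in> {1..n}" "u \<in> {1..n}" "v \<in> {1..n}" using xy uv D(1) by auto
  let ?E = "switch x y u v E"
  have "?E \<subseteq> {1..n} \<times> {1..n}" using V D(1) unfolding switch_def by auto
  moreover have "irrefl ?E" using irr dist by (auto simp: switch_def irrefl_def)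
  moreover have "sym ?E" using sym by (auto simp: switch_def sym_def)
  moreover have "card (?E `` {z}) = r" if z: "z \<in> {1..n}" for z
  proof -
    have swap: "card (insert b (E `` {z} - {a})) = r" if "a \<in> E `` {z}" "b \<notin> E `` {z}" for a b
    proof -
      have "card (insert b (E `` {z} - {a})) = Suc (card (E `` {z} - {a}))"
        using that D(6) by (subst card_insert_disjoint) auto
      also have "\<dots> = card (E `` {z})"
        using that(1) D(6) by (metis card_Suc_Diff1)
      finally show ?thesis using D(5)[OF z] by simp
    qed
    consider "z = x" | "z = y" | "z = u" | "z = v" | "z \<notin> {x, y, u, v}" by blast
    then show ?thesis
    proof cases
      case 1
      then have "?E `` {z} = insert u (E `` {z} - {y})" using dist by (auto simp: switch_def)
      then show ?thesis using swap[of y u] 1 xy u by auto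
    next
      case 2
      then have "?E `` {z} = insert v (E `` {z} - {x})" using dist by (auto simp: switch_def)
      then show ?thesis using swap[of x v] 2 sym[OF xy] v by auto
    next
      case 3
      then have "?E `` {z} = insert x (E `` {z} - {v})" using dist by (auto simp: switch_def)
      then show ?thesis using swap[of v x] 3 uv u sym by auto
    next
      case 4
      then have "?E `` {z} = insert y (E `` {z} - {u})" using dist by (auto simp: switch_def)
      then show ?thesis using swap[of u y] 4 sym[OF uv] v sym by auto
    next
      case 5
      then have "?E `` {z} = E `` {z}" by (auto simp: switch_def)
      then show ?thesis using D(5)[OF z] by simp
    qed
  qed
  ultimately show ?thesis by (auto simp: regular_graphs_def)
qed

text \<open>The inverse is again a switching, with the roles of \<open>y\<close> and
  \<open>u\<close> exchanged. So the result and the pair \<open>(u, v)\<close> determine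
  \<open>E\<close>, which gives the injectivity in the double counting.\<close>

lemma switch_undo:
  assumes E: "E \<in> regular_graphs r n" and xy: "(x, y) \<in> E" and uv: "(u, v) \<in> E"
    and u: "u \<notin> insert x (E `` {x})" and v: "v \<notin> insert y (E `` {y})"
  shows "switch x u y v (switch x y u v E) = E"
proof -
  note D = regular_graphsD[OF E]
  have sym: "(b, a) \<in> E" if "(a, b) \<in> E" for a b using D(3) that by (auto simp: sym_def)
  have irr: "(a, a) \<notin> E" for a using D(4) by (auto simp: irrefl_def)
  have dist: "x \<noteq> y" "u \<noteq> v" "u \<noteq> x" "u \<noteq> y" "v \<noteq> x" "v \<noteq> y"
    using xy uv u v irr sym by auto
  have in': "(x,y) \<in> E" "(y,x) \<in> E" "(u,v) \<in> E" "(v,u) \<in> E" using xy uv sym by auto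
  have out: "(x,u) \<notin> E" "(u,x) \<notin> E" "(y,v) \<notin> E" "(v,y) \<notin> E" using u v sym by auto
  show ?thesis unfolding switch_def using in' out dist by auto
qed

text \<open>Double counting of the switchings that replace \<open>xy\<close> and an edge \<open>uv\<close> outside \<open>F\<close> by \<open>xu\<close> and
  \<open>yv\<close>: few \<open>uv\<close> are excluded, and a switching is determined by its result together with a neighbour
  \<open>u\<close> of \<open>x\<close> and a neighbour \<open>v\<close> of \<open>y\<close>.\<close>

lemma switching_count:
  assumes F: "finite F" "(x, y) \<notin> F" "(y, x) \<notin> F"
  shows "card {E \<in> regular_graphs r n. insert (x, y) F \<subseteq> E} *
           (r * n - 2 * card F - 2 * r * (r + 1))
         \<le> r\<^sup>2 * card {E \<in> regular_graphs r n. F \<subseteq> E}"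
proof -
  define G1 where "G1 = {E \<in> regular_graphs r n. insert (x, y) F \<subseteq> E}"
  define G0 where "G0 = {E \<in> regular_graphs r n. F \<subseteq> E}"
  define k where "k = r * n - 2 * card F - 2 * r * (r + 1)"
  define Q where "Q E = {(u, v) \<in> E. (u, v) \<notin> F \<and> (v, u) \<notin> F \<and>
      u \<notin> insert x (E `` {x}) \<and> v \<notin> insert y (E `` {y})}" for E :: "(nat \<times> nat) set"
  define f where "f = (\<lambda>(E, (u, v)). (switch x y u v E, (u, v)))"
  have fin: "finite G1" "finite G0" using finite_regular_graphs by (auto simp: G1_def G0_def)
  have G1: "E \<in> regular_graphs r n" "(x, y) \<in> E" "F \<subseteq> E" if "E \<in> G1" for E
    using that by (auto simp: G1_def)
  have finQ: "finite (Q E)" if "E \<in> G1" for E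
    using regular_graphsD(2)[OF G1(1)[OF that]] by (rule rev_finite_subset) (auto simp: Q_def)
  \<comment> \<open>The excluded oriented edges lie in \<open>F\<close> in one of the two
    orientations, start in the closed neighbourhood of \<open>x\<close>, or end in that of
    \<open>y\<close>.\<close>
  have Q_card: "k \<le> card (Q E)" if "E \<in> G1" for E
  proof -
    note E = G1[OF that]
    note D = regular_graphsD[OF E(1)]
    let ?X = "insert x (E `` {x})" and ?Y = "insert y (E `` {y})"
    have X: "card ?X \<le> r + 1" "card ?Y \<le> r + 1"
      using D(6,7) by (auto simp: card_insert_if le_SucI)
    have finX: "finite ?X" "finite ?Y" using D(6) by auto
    have "E \<subseteq> Q E \<union> (F \<union> F\<inverse>) \<union> ({(u, v) \<in> E. u \<in> ?X} \<union> {(u, v) \<in> E. v \<in> ?Y})"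
      by (auto simp: Q_def)
    then have "card E \<le> card (Q E \<union> (F \<union> F\<inverse>) \<union> ({(u, v) \<in> E. u \<in> ?X} \<union> {(u, v) \<in> E. v \<in> ?Y}))"
      using F(1) finQ[OF that] D(2)
      by (intro card_mono) (auto intro: finite_subset[OF _ D(2)])
    also have "\<dots> \<le> (card (Q E) + (card F + card (F\<inverse>))) +
        (card {(u, v) \<in> E. u \<in> ?X} + card {(u, v) \<in> E. v \<in> ?Y})"
      by (intro order_trans[OF card_Un_le] add_mono card_Un_le order_refl)
    also have "\<dots> \<le> card (Q E) + 2 * card F + 2 * r * (r + 1)"
    proof -
      have "card {(u, v) \<in> E. u \<in> ?X} \<le> (r + 1) * r" "card {(u, v) \<in> E. v \<in> ?Y} \<le> (r + 1) * r"
        by (rule order_trans[OF card_edges_from[OF E(1) finX(1)] mult_le_mono1[OF X(1)]],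
            rule order_trans[OF card_edges_to[OF E(1) finX(2)] mult_le_mono1[OF X(2)]])
      moreover have "card (F\<inverse>) = card F" by simp
      ultimately show ?thesis by (simp add: algebra_simps)
    qed
    finally show ?thesis using card_edges[OF E(1)] by (simp add: k_def mult.commute)
  qed
  have "card G1 * k = (\<Sum>E\<in>G1. k)" by simp
  also have "\<dots> \<le> (\<Sum>E\<in>G1. card (Q E))" by (intro sum_mono Q_card)
  also have "\<dots> = card (Sigma G1 Q)" using fin finQ by (simp add: card_SigmaI)
  \<comment> \<open>After the switching \<open>u\<close> is a neighbour of \<open>x\<close> and
    \<open>v\<close> one of \<open>y\<close>, so a graph in \<open>G0\<close> arises in at most
    \<open>r ^ 2\<close> ways.\<close>
  also have "\<dots> \<le> card (Sigma G0 (\<lambda>E. E `` {x} \<times> E `` {y}))"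
  proof (rule card_inj_on_le[of f])
    show "inj_on f (Sigma G1 Q)"
    proof (rule inj_on_inverseI[where g = "\<lambda>(E, (u, v)). (switch x u y v E, (u, v))"])
      fix p assume "p \<in> Sigma G1 Q"
      then obtain E u v where p: "p = (E, (u, v))" "E \<in> G1" "(u, v) \<in> Q E" by auto
      show "(\<lambda>(E, (u, v)). (switch x u y v E, (u, v))) (f p) = p"
        using switch_undo[OF G1(1,2)[OF p(2)]] p by (auto simp: f_def Q_def)
    qed
    show "f ` Sigma G1 Q \<subseteq> Sigma G0 (\<lambda>E. E `` {x} \<times> E `` {y})"
    proof safe
      fix a b c E u v assume E: "E \<in> G1" and uv: "(u, v) \<in> Q E" and ab: "(a, b, c) = f (E, (u, v))"
      have "switch x y u v E \<in> regular_graphs r n"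
        using uv by (intro switch_regular G1(1,2)[OF E]) (auto simp: Q_def)
      moreover have "F \<subseteq> switch x y u v E"
        using G1(3)[OF E] uv F by (auto simp: Q_def switch_def)
      ultimately show "a \<in> G0" using ab by (auto simp: f_def G0_def)
      show "(x, b) \<in> a" "(y, c) \<in> a" using ab by (auto simp: f_def switch_def)
    qed
    show "finite (Sigma G0 (\<lambda>E. E `` {x} \<times> E `` {y}))"
      using fin regular_graphsD(6) by (auto simp: G0_def)
  qed
  also have "\<dots> = (\<Sum>E\<in>G0. card (E `` {x} \<times> E `` {y}))"
    using fin regular_graphsD(6) by (subst card_SigmaI) (auto simp: G0_def)
  also have "\<dots> \<le> (\<Sum>E\<in>G0. r\<^sup>2)"
    unfolding card_cartesian_product power2_eq_square
    by (intro sum_mono mult_le_mono regular_graphsD(7)) (auto simp: G0_def)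
  finally show ?thesis by (simp add: G0_def G1_def k_def mult.commute)
qed

text \<open>Asymmetry of \<open>F\<close> means that each undirected edge is listed in one orientation only, so that
  \<open>card F\<close> is the number of edges.\<close>

lemma card_containing_le:
  assumes "finite F" "asym F" "card F \<le> m" and k: "k = real r * real n - 2 * real m - 2 * real r * (real r + 1)" "k > 0"
  shows "real (card {E \<in> regular_graphs r n. F \<subseteq> E})
           \<le> ((real r)\<^sup>2 / k) ^ card F * real (card (regular_graphs r n))"
  using assms(1-3)
proof (induction F)
  case empty
  then show ?case by simp
next
  case (insert e F)
  obtain x y where e: "e = (x, y)" by (cases e)
  have nn: "(b, a) \<notin> insert e F" if "(a, b) \<in> insert e F" for a b
    using asymD[OF insert.prems(1) that] .
  have a: "asym F" by (rule asymI) (meson insertCI nn)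
  have yx: "(y, x) \<notin> F" using nn[of x y] by (simp add: e)
  define a1 where "a1 = real (card {E \<in> regular_graphs r n. insert e F \<subseteq> E})"
  define a0 where "a0 = real (card {E \<in> regular_graphs r n. F \<subseteq> E})"
  have c: "card F \<le> m" using insert.prems(2) insert.hyps by simp
  have "a1 * real (r * n - 2 * card F - 2 * r * (r + 1)) \<le> (real r)\<^sup>2 * a0"
  proof -
    have "card {E \<in> regular_graphs r n. insert e F \<subseteq> E} * (r * n - 2 * card F - 2 * r * (r + 1))
        \<le> r\<^sup>2 * card {E \<in> regular_graphs r n. F \<subseteq> E}"
      unfolding e using insert.hyps(2) yx by (intro switching_count insert.hyps(1)) (simp_all add: e)
    then show ?thesis
      unfolding a1_def a0_def of_nat_power[symmetric] of_nat_mult[symmetric] of_nat_le_iff .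
  qed
  \<comment> \<open>\<open>k\<close> is formed with the bound \<open>m\<close> instead of
    \<open>card F\<close>, so the same factor serves at every step of the induction.\<close>
  moreover have "k \<le> real (r * n - 2 * card F - 2 * r * (r + 1))"
  proof -
    have "k \<le> real r * real n - 2 * real (card F) - 2 * real r * (real r + 1)"
      using c k by simp
    also have "\<dots> \<le> real (r * n - 2 * card F - 2 * r * (r + 1))"
    proof -
      have "real a - real b - real c \<le> real (a - b - c)" for a b c :: nat by linarith
      from this[of "r * n" "2 * card F" "2 * r * (r + 1)"]
      show ?thesis unfolding of_nat_mult of_nat_add by simp
    qed
    finally show ?thesis .
  qed
  moreover have "a1 \<ge> 0" by (simp add: a1_def)
  ultimately have "a1 * k \<le> (real r)\<^sup>2 * a0"
    by (meson mult_left_mono order_trans)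
  then have "a1 \<le> (real r)\<^sup>2 / k * a0" using k(2) by (simp add: field_simps)
  also have "\<dots> \<le> (real r)\<^sup>2 / k * (((real r)\<^sup>2 / k) ^ card F * real (card (regular_graphs r n)))"
    unfolding a0_def using k(2) by (intro mult_left_mono insert.IH a c) auto
  finally show ?case using insert.hyps by (simp add: a1_def mult.assoc)
qed

section \<open>Exponential moments, tails of edge counts and discrepancy\<close>

lemma sum_power_card_Pow:
  fixes t :: real
  assumes "finite P"
  shows "(\<Sum>F\<in>Pow P. t ^ card F) = (1 + t) ^ card P"
  using assms
proof (induction P)
  case (insert x P)
  have inj: "inj_on (insert x) (Pow P)" using insert.hyps by (auto simp: inj_on_def)
  have "(\<Sum>F\<in>Pow (insert x P). t ^ card F) = (\<Sum>F\<in>Pow P. t ^ card F) + (\<Sum>F\<in>insert x ` Pow P. t ^ card F)"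
    unfolding Pow_insert using insert.hyps by (intro sum.union_disjoint) auto
  also have "(\<Sum>F\<in>insert x ` Pow P. t ^ card F) = (\<Sum>F\<in>Pow P. t * t ^ card F)"
    unfolding sum.reindex[OF inj]
  proof (rule sum.cong)
    fix F assume "F \<in> Pow P"
    then have "x \<notin> F" "finite F" using insert.hyps finite_subset by auto
    then show "((\<lambda>F. t ^ card F) \<circ> insert x) F = t * t ^ card F" by simp
  qed simp
  finally show ?case using insert by (simp add: sum_distrib_left[symmetric] algebra_simps)
qed simp

text \<open>Exponential moments: expand \<open>exp (\<theta> * card (E \<inter> P)) = (1 + t) ^ card (E \<inter> P)\<close> over the subsets
  of \<open>E \<inter> P\<close>.\<close>

lemma edge_count_tail:
  fixes c \<theta> :: real
  assumes P: "finite P" "asym P"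
    and m: "\<And>E. E \<in> regular_graphs r n \<Longrightarrow> card (E \<inter> P) \<le> m"
    and k: "k = real r * real n - 2 * real m - 2 * real r * (real r + 1)" "k > 0"
    and \<theta>: "\<theta> \<ge> 0"
  shows "real (card {E \<in> regular_graphs r n. c \<le> real (card (E \<inter> P))})
           \<le> exp ((exp \<theta> - 1) * ((real r)\<^sup>2 / k) * real (card P) - \<theta> * c)
              * real (card (regular_graphs r n))"
proof -
  define G where "G = regular_graphs r n"
  define t where "t = exp \<theta> - 1"
  define q where "q = (real r)\<^sup>2 / k"
  have fin: "finite G" by (simp add: G_def finite_regular_graphs)
  have t: "t \<ge> 0" using \<theta> by (simp add: t_def)
  have q: "q \<ge> 0" using k by (simp add: q_def)
  have "real (card {E \<in> G. c \<le> real (card (E \<inter> P))}) * exp (\<theta> * c) =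
      (\<Sum>E\<in>{E \<in> G. c \<le> real (card (E \<inter> P))}. exp (\<theta> * c))" by simp
  also have "\<dots> \<le> (\<Sum>E\<in>{E \<in> G. c \<le> real (card (E \<inter> P))}. exp (\<theta> * real (card (E \<inter> P))))"
    using \<theta> by (intro sum_mono) (auto intro: mult_left_mono)
  also have "\<dots> \<le> (\<Sum>E\<in>G. exp (\<theta> * real (card (E \<inter> P))))"
    using fin by (intro sum_mono2) auto
  also have "\<dots> = (\<Sum>E\<in>G. (\<Sum>F\<in>{F \<in> Pow P. F \<subseteq> E}. t ^ card F))"
  proof (rule sum.cong)
    fix E
    have "exp (\<theta> * real (card (E \<inter> P))) = (1 + t) ^ card (E \<inter> P)"
      by (simp add: t_def exp_of_nat2_mult)
    also have "\<dots> = (\<Sum>F\<in>Pow (E \<inter> P). t ^ card F)"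
      using P by (intro sum_power_card_Pow[symmetric]) auto
    also have "Pow (E \<inter> P) = {F \<in> Pow P. F \<subseteq> E}" by auto
    finally show "exp (\<theta> * real (card (E \<inter> P))) = (\<Sum>F\<in>{F \<in> Pow P. F \<subseteq> E}. t ^ card F)" .
  qed simp
  also have "\<dots> = (\<Sum>F\<in>Pow P. (\<Sum>E\<in>{E \<in> G. F \<subseteq> E}. t ^ card F))"
    using fin P by (intro sum.swap_restrict) auto
  also have "\<dots> = (\<Sum>F\<in>Pow P. t ^ card F * real (card {E \<in> G. F \<subseteq> E}))"
    by (simp add: mult.commute)
  also have "\<dots> \<le> (\<Sum>F\<in>Pow P. t ^ card F * (q ^ card F * real (card G)))"
  proof (rule sum_mono)
    fix F assume F: "F \<in> Pow P"
    show "t ^ card F * real (card {E \<in> G. F \<subseteq> E}) \<le> t ^ card F * (q ^ card F * real (card G))"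
    \<comment> \<open>A set contained in no regular graph contributes zero. For any other
      \<open>F\<close> the bound on \<open>card (E \<inter> P)\<close> yields
      \<open>card F \<le> m\<close>, as \<open>card_containing_le\<close> requires.\<close>
    proof (cases "\<exists>E\<in>G. F \<subseteq> E")
      case True
      then obtain E where E: "E \<in> G" "F \<subseteq> E" by auto
      have "card F \<le> card (E \<inter> P)" using E F P by (intro card_mono) auto
      also have "\<dots> \<le> m" using E m by (simp add: G_def)
      finally have "card F \<le> m" .
      moreover have "asym F" using P(2) F by (auto simp: asym_on_def)
      ultimately show ?thesis
        unfolding G_def q_def using F P t k
        by (intro mult_left_mono card_containing_le[where m = m] finite_subset[OF _ P(1)]) auto
    next
      case False
      then have "{E \<in> G. F \<subseteq> E} = {}" by auto
      then show ?thesis using t q by (simp only:) simp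
    qed
  qed
  also have "\<dots> = (\<Sum>F\<in>Pow P. (t * q) ^ card F) * real (card G)"
    by (simp add: sum_distrib_right power_mult_distrib mult.assoc)
  also have "\<dots> = (1 + t * q) ^ card P * real (card G)"
    using P by (simp add: sum_power_card_Pow)
  also have "\<dots> \<le> exp (t * q) ^ card P * real (card G)"
    using t q by (intro mult_right_mono power_mono) auto
  also have "\<dots> = exp (t * q * real (card P)) * real (card G)"
    by (simp add: exp_of_nat2_mult)
  finally have "real (card {E \<in> G. c \<le> real (card (E \<inter> P))}) * exp (\<theta> * c)
      \<le> exp (t * q * real (card P)) * real (card G)" .
  then show ?thesis
    by (simp add: G_def t_def q_def exp_diff field_simps)
qed

text \<open>The decreasing pairs of \<open>E \<inter> S \<times> A\<close> are the converses of
  increasing edges from \<open>A\<close> to \<open>S\<close>. The split produces asymmetric sets, to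
  which the moment bound applies.\<close>

lemma card_edges_between:
  assumes E: "E \<in> regular_graphs r n"
  shows "card (E \<inter> S \<times> A) =
    card (E \<inter> {(x, y) \<in> S \<times> A. x < y}) + card (E \<inter> {(x, y) \<in> A \<times> S. x < y})"
proof -
  note D = regular_graphsD[OF E]
  have "E \<inter> S \<times> A = (E \<inter> {(x, y) \<in> S \<times> A. x < y}) \<union> (E \<inter> {(x, y) \<in> A \<times> S. x < y})\<inverse>"
    using D(3,4) by (auto simp: sym_def irrefl_def) (metis linorder_neqE_nat)
  then have "card (E \<inter> S \<times> A) =
      card ((E \<inter> {(x, y) \<in> S \<times> A. x < y}) \<union> (E \<inter> {(x, y) \<in> A \<times> S. x < y})\<inverse>)"
    by (rule arg_cong)
  also have "\<dots> = card (E \<inter> {(x, y) \<in> S \<times> A. x < y}) + card ((E \<inter> {(x, y) \<in> A \<times> S. x < y})\<inverse>)"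
    using D(2) by (intro card_Un_disjoint) auto
  finally show ?thesis by simp
qed

text \<open>A Chernoff bound with \<open>\<theta> = \<epsilon> / 4\<close>. Since
  \<open>exp \<theta> - 1 - \<theta> \<le> \<theta> ^ 2\<close> on the unit interval and
  \<open>q * card P\<close>, which stands in for the mean, is at most \<open>2 * r * s\<close>, the
  exponent is at most \<open>(2/16 - 1/4) * r * s * \<epsilon> ^ 2\<close>.\<close>

lemma edge_excess_tail:
  fixes \<epsilon> q :: real
  assumes P: "P \<subseteq> {(x, y). x < y}" "finite P" "card P \<le> s * n"
    and m: "\<And>E. E \<in> regular_graphs r n \<Longrightarrow> card (E \<inter> P) \<le> s * r"
    and k: "k = real r * real n - 2 * real (s * r) - 2 * real r * (real r + 1)" "k > 0"
    and q: "q = (real r)\<^sup>2 / k" "q * real n \<le> 2 * real r"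
    and \<epsilon>: "0 \<le> \<epsilon>" "\<epsilon> \<le> 1"
  shows "real (card {E \<in> regular_graphs r n. q * card P + \<epsilon> * r * s \<le> real (card (E \<inter> P))})
           \<le> exp (- (real r * s * \<epsilon>\<^sup>2 / 8)) * real (card (regular_graphs r n))"
proof -
  have "asym P"
  proof (rule asymI)
    fix x y assume "(x, y) \<in> P"
    then have "x < y" using P(1) by auto
    then show "(y, x) \<notin> P" using P(1) by auto
  qed
  define \<theta> where "\<theta> = \<epsilon> / 4"
  have \<theta>: "0 \<le> \<theta>" "\<theta> \<le> 1" using \<epsilon> by (auto simp: \<theta>_def)
  have q0: "q \<ge> 0" using q k by simp
  have "q * card P \<le> q * (s * n)"
    using P(3) q0 by (intro mult_left_mono) (auto simp flip: of_nat_mult)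
  also have "\<dots> = q * n * s" by simp
  also have "\<dots> \<le> 2 * real r * real s" using mult_right_mono[OF q(2), of "real s"] by simp
  finally have qP: "q * card P \<le> 2 * real r * real s" .
  have "(exp \<theta> - 1) * q * card P - \<theta> * (q * card P + \<epsilon> * r * s) =
      (exp \<theta> - 1 - \<theta>) * (q * card P) - \<theta> * \<epsilon> * r * s"
    by (simp add: algebra_simps)
  also have "\<dots> \<le> \<theta>\<^sup>2 * (2 * real r * real s) - \<theta> * \<epsilon> * r * s"
    using exp_bound[OF \<theta>] q0 by (intro diff_right_mono mult_mono[OF _ qP]) auto
  also have "\<dots> = - (real r * s * \<epsilon>\<^sup>2 / 8)"
    by (simp add: \<theta>_def power2_eq_square field_simps)
  finally have *: "(exp \<theta> - 1) * q * card P - \<theta> * (q * card P + \<epsilon> * r * s)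
      \<le> - (real r * s * \<epsilon>\<^sup>2 / 8)" .
  have "real (card {E \<in> regular_graphs r n. q * card P + \<epsilon> * r * s \<le> real (card (E \<inter> P))})
      \<le> exp ((exp \<theta> - 1) * ((real r)\<^sup>2 / k) * card P - \<theta> * (q * card P + \<epsilon> * r * s))
              * real (card (regular_graphs r n))"
    using P \<open>asym P\<close> m k \<theta> by (intro edge_count_tail[where m = "s * r"]) auto
  also have "\<dots> \<le> exp (- (real r * s * \<epsilon>\<^sup>2 / 8)) * real (card (regular_graphs r n))"
    using * q(1) by (intro mult_right_mono) auto
  finally show ?thesis .
qed

text \<open>Only an excess of edges is recorded, because too few neighbours in a set mean too many
  in its complement. The slack carries a factor 2 because each of the two orientations is allowed an
  excess of \<open>\<epsilon> * r * s\<close>.\<close>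

definition discrepant :: "nat \<Rightarrow> nat \<Rightarrow> nat \<Rightarrow> real \<Rightarrow> real \<Rightarrow> (nat \<times> nat) set \<Rightarrow> bool" where
  "discrepant r n s q \<epsilon> E \<longleftrightarrow>
     (\<exists>S A. S \<subseteq> {1..n} \<and> A \<subseteq> {1..n} \<and> card S = s \<and>
        q * real s * real (card A) + 2 * \<epsilon> * real r * real s \<le> real (card (E \<inter> S \<times> A)))"

lemma discrepant_pair_le:
  fixes \<epsilon> q :: real
  assumes S: "S \<subseteq> {1..n}" "A \<subseteq> {1..n}" "card S = s"
    and k: "k = real r * real n - 2 * real (s * r) - 2 * real r * (real r + 1)" "k > 0"
    and q: "q = (real r)\<^sup>2 / k" "q * real n \<le> 2 * real r"
    and \<epsilon>: "0 \<le> \<epsilon>" "\<epsilon> \<le> 1"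
  shows "real (card {E \<in> regular_graphs r n.
              q * real s * real (card A) + 2 * \<epsilon> * real r * real s \<le> real (card (E \<inter> S \<times> A))})
           \<le> 2 * exp (- (real r * s * \<epsilon>\<^sup>2 / 8)) * real (card (regular_graphs r n))"
proof -
  let ?G = "regular_graphs r n"
  \<comment> \<open>\<open>S\<close> and \<open>A\<close> may overlap, so \<open>S \<times> A\<close> need not be asymmetric; it is split by orientation.\<close>
  define P1 where "P1 = {(x, y) \<in> S \<times> A. x < y}"
  define P2 where "P2 = {(x, y) \<in> A \<times> S. x < y}"
  define Q where "Q P = {E \<in> ?G. q * card P + \<epsilon> * r * s \<le> real (card (E \<inter> P))}" for P
  have fin: "finite S" "finite A" using S finite_subset by auto
  have cA: "card A \<le> n" using card_mono[OF _ S(2)] by simp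
  have finP: "finite P1" "finite P2"
    using fin by (auto simp: P1_def P2_def intro: finite_subset[of _ "S \<times> A"] finite_subset[of _ "A \<times> S"])
  have "card P1 + card P2 = card (P1 \<union> P2\<inverse>)"
    using finP by (subst card_Un_disjoint) (auto simp: P1_def P2_def)
  also have "\<dots> \<le> card (S \<times> A)"
    using fin by (intro card_mono) (auto simp: P1_def P2_def)
  finally have c: "card P1 + card P2 \<le> s * card A" using S by (simp add: card_cartesian_product)
  have "s * card A \<le> s * n" using cA by simp
  then have c': "card P1 \<le> s * n" "card P2 \<le> s * n" using c by linarith+
  have q0: "q \<ge> 0" using q k by simp
  have b1: "real (card (Q P1)) \<le> exp (- (real r * s * \<epsilon>\<^sup>2 / 8)) * real (card ?G)"
    unfolding Q_def
  proof (rule edge_excess_tail[OF _ finP(1) _ _ k q \<epsilon>])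
    fix E assume E: "E \<in> ?G"
    have "card (E \<inter> P1) \<le> card {(u, v) \<in> E. u \<in> S}"
      using regular_graphsD(2)[OF E] by (intro card_mono) (auto simp: P1_def intro: rev_finite_subset)
    then show "card (E \<inter> P1) \<le> s * r" using card_edges_from[OF E fin(1)] S by simp
  qed (use c' in \<open>auto simp: P1_def\<close>)
  have b2: "real (card (Q P2)) \<le> exp (- (real r * s * \<epsilon>\<^sup>2 / 8)) * real (card ?G)"
    unfolding Q_def
  proof (rule edge_excess_tail[OF _ finP(2) _ _ k q \<epsilon>])
    fix E assume E: "E \<in> ?G"
    have "card (E \<inter> P2) \<le> card {(u, v) \<in> E. v \<in> S}"
      using regular_graphsD(2)[OF E] by (intro card_mono) (auto simp: P2_def intro: rev_finite_subset)
    then show "card (E \<inter> P2) \<le> s * r" using card_edges_to[OF E fin(1)] S by simp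
  qed (use c' in \<open>auto simp: P2_def\<close>)
  \<comment> \<open>If both orientations stay below their own thresholds, the two counts add up to
    less than the threshold for \<open>S \<times> A\<close>.\<close>
  have "{E \<in> ?G. q * real s * real (card A) + 2 * \<epsilon> * real r * real s \<le> real (card (E \<inter> S \<times> A))}
      \<subseteq> Q P1 \<union> Q P2"
  proof safe
    fix E assume E: "E \<in> ?G" "E \<notin> Q P2"
      and *: "q * real s * real (card A) + 2 * \<epsilon> * real r * real s \<le> real (card (E \<inter> S \<times> A))"
    have "card (E \<inter> S \<times> A) = card (E \<inter> P1) + card (E \<inter> P2)"
      using card_edges_between[OF E(1)] by (simp add: P1_def P2_def)
    moreover have "q * (real (card P1) + real (card P2)) \<le> q * (real s * real (card A))"
      using c q0 by (intro mult_left_mono) (simp_all flip: of_nat_mult of_nat_add)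
    ultimately show "E \<in> Q P1"
      using E * by (simp add: Q_def algebra_simps)
  qed
  moreover have finQ: "finite (Q P1 \<union> Q P2)" using finite_regular_graphs by (auto simp: Q_def)
  ultimately have "card {E \<in> ?G. q * real s * real (card A) + 2 * \<epsilon> * real r * real s
      \<le> real (card (E \<inter> S \<times> A))} \<le> card (Q P1 \<union> Q P2)" by (intro card_mono)
  also have "\<dots> \<le> card (Q P1) + card (Q P2)" by (rule card_Un_le)
  finally show ?thesis using b1 b2 by linarith
qed

text \<open>Union bound over at most \<open>4 ^ n\<close> pairs \<open>(S, A)\<close>. As
  \<open>s \<ge> \<epsilon> * n\<close> and \<open>r * \<epsilon> ^ 3 \<ge> 24\<close>, each pair is
  bad for a fraction of at most \<open>2 * exp (- 3 * n) \<le> 2 * (1/8) ^ n\<close> of the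
  graphs.\<close>

lemma discrepant_le:
  fixes \<epsilon> q :: real
  assumes k: "k = real r * real n - 2 * real (s * r) - 2 * real r * (real r + 1)" "k > 0"
    and q: "q = (real r)\<^sup>2 / k" "q * real n \<le> 2 * real r"
    and \<epsilon>: "0 \<le> \<epsilon>" "\<epsilon> \<le> 1" "\<epsilon> * real n \<le> real s" "24 \<le> real r * \<epsilon> ^ 3"
  shows "real (card {E \<in> regular_graphs r n. discrepant r n s q \<epsilon> E})
           \<le> 2 * (1 / 2) ^ n * real (card (regular_graphs r n))"
proof -
  let ?G = "regular_graphs r n"
  define I where "I = {S. S \<subseteq> {1..n} \<and> card S = s} \<times> Pow {1..n}"
  define Q where "Q = (\<lambda>(S, A). {E \<in> ?G.
    q * real s * real (card A) + 2 * \<epsilon> * real r * real s \<le> real (card (E \<inter> S \<times> A))})"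
  have IU: "I \<subseteq> Pow {1..n} \<times> Pow {1..n}" by (auto simp: I_def)
  have finI: "finite I" by (rule finite_subset[OF IU]) auto
  have "card I \<le> card (Pow {1..n} \<times> Pow {1..n})" by (rule card_mono[OF _ IU]) auto
  then have cI: "card I \<le> 4 ^ n"
    by (simp add: card_cartesian_product card_Pow flip: power_mult_distrib)
  have "3 * real n = 24 * n / 8" by simp
  also have "\<dots> \<le> r * \<epsilon> ^ 3 * n / 8" using mult_right_mono[OF \<epsilon>(4), of "real n"] by simp
  also have "\<dots> = r * (\<epsilon> * n) * \<epsilon>\<^sup>2 / 8" by (simp add: power2_eq_square power3_eq_cube)
  also have "\<dots> \<le> real r * real s * \<epsilon>\<^sup>2 / 8"
    using \<epsilon> by (intro divide_right_mono mult_right_mono mult_left_mono) auto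
  finally have 3: "3 * real n \<le> real r * real s * \<epsilon>\<^sup>2 / 8" .
  have "(8::real) = 2 ^ 3" by simp
  also have "\<dots> \<le> exp 1 ^ 3" using exp_ge_add_one_self[of 1] by (intro power_mono) auto
  also have "\<dots> = exp 3" by (simp flip: exp_of_nat_mult)
  finally have e: "8 \<le> exp (3::real)" .
  have "{E \<in> ?G. discrepant r n s q \<epsilon> E} = (\<Union>p\<in>I. Q p)"
    by (auto simp: discrepant_def I_def Q_def)
  then have "card {E \<in> ?G. discrepant r n s q \<epsilon> E} \<le> (\<Sum>p\<in>I. card (Q p))"
    using card_UN_le[OF finI] by simp
  then have "real (card {E \<in> ?G. discrepant r n s q \<epsilon> E}) \<le> (\<Sum>p\<in>I. real (card (Q p)))"
    by (simp flip: of_nat_sum)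
  also have "\<dots> \<le> (\<Sum>p\<in>I. 2 * exp (- (real r * s * \<epsilon>\<^sup>2 / 8)) * real (card ?G))"
  proof (rule sum_mono)
    fix p assume "p \<in> I"
    then obtain S A where p: "p = (S, A)" "S \<subseteq> {1..n}" "A \<subseteq> {1..n}" "card S = s"
      by (auto simp: I_def)
    show "real (card (Q p)) \<le> 2 * exp (- (real r * s * \<epsilon>\<^sup>2 / 8)) * real (card ?G)"
      unfolding p(1) Q_def using discrepant_pair_le[OF p(2-4) k q \<epsilon>(1,2)] by simp
  qed
  also have "\<dots> = real (card I) * (2 * exp (- (real r * s * \<epsilon>\<^sup>2 / 8)) * real (card ?G))" by simp
  also have "\<dots> \<le> 4 ^ n * (2 * (1 / 8) ^ n * real (card ?G))"
  proof (intro mult_mono)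
    show "real (card I) \<le> 4 ^ n" using cI by (metis of_nat_le_iff of_nat_numeral of_nat_power)
    have "exp (- (real r * s * \<epsilon>\<^sup>2 / 8)) \<le> exp (- (3 * real n))" using 3 by simp
    also have "\<dots> = inverse (exp 3) ^ n"
      by (simp add: exp_minus power_inverse flip: exp_of_nat2_mult)
    also have "\<dots> \<le> (1 / 8) ^ n"
      using e by (intro power_mono) (auto simp: field_simps)
    finally show "exp (- (real r * s * \<epsilon>\<^sup>2 / 8)) \<le> (1 / 8) ^ n" .
  qed auto
  also have "\<dots> = 2 * (4 * (1 / 8)) ^ n * real (card ?G)"
    unfolding power_mult_distrib by simp
  finally show ?thesis by simp
qed

section \<open>Mean numbers of triangles and 4-cycles\<close>

definition triangles :: "(nat \<times> nat) set \<Rightarrow> ((nat \<times> nat) \<times> nat) set" where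
  "triangles E = {((u, w), v). (u, w) \<in> E \<and> (u, v) \<in> E \<and> (v, w) \<in> E}"

text \<open>The 4-cycle \<open>u, v, w, z\<close> is recorded by its two pairs of opposite corners,
  so that \<open>(v, z)\<close> is an ordered pair of distinct common neighbours of \<open>u\<close>
  and \<open>w\<close>.\<close>

definition squares :: "(nat \<times> nat) set \<Rightarrow> ((nat \<times> nat) \<times> (nat \<times> nat)) set" where
  "squares E = {((u, w), (v, z)). u \<noteq> w \<and> v \<noteq> z \<and>
     (u, v) \<in> E \<and> (v, w) \<in> E \<and> (u, z) \<in> E \<and> (z, w) \<in> E}"

text \<open>After interchanging the sums, each of at most \<open>n ^ j\<close> placements occurs in
  at most a fraction \<open>q ^ j\<close> of the graphs. As \<open>q * n \<le> 2 * r\<close>, the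
  mean number of copies stays bounded when \<open>n\<close> grows.\<close>

lemma sum_card_copies_le:
  assumes X: "finite X" "\<And>p. p \<in> X \<Longrightarrow> finite (F p) \<and> asym (F p) \<and> card (F p) = j" "j \<le> m"
    and k: "k = real r * real n - 2 * real m - 2 * real r * (real r + 1)" "k > 0"
    and q: "q = (real r)\<^sup>2 / k" "q * real n \<le> 2 * real r"
    and c: "card X \<le> n ^ j"
  shows "(\<Sum>E\<in>regular_graphs r n. real (card {p \<in> X. F p \<subseteq> E}))
           \<le> (2 * real r) ^ j * real (card (regular_graphs r n))"
proof -
  let ?G = "regular_graphs r n"
  have q0: "q \<ge> 0" using q k by simp
  have "(\<Sum>E\<in>?G. real (card {p \<in> X. F p \<subseteq> E})) = (\<Sum>E\<in>?G. (\<Sum>p\<in>{p \<in> X. F p \<subseteq> E}. 1))"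
    by simp
  also have "\<dots> = (\<Sum>p\<in>X. (\<Sum>E\<in>{E \<in> ?G. F p \<subseteq> E}. 1))"
    using finite_regular_graphs X(1) by (rule sum.swap_restrict)
  also have "\<dots> \<le> (\<Sum>p\<in>X. q ^ j * real (card ?G))"
  proof (rule sum_mono)
    fix p assume "p \<in> X"
    then have F: "finite (F p)" "asym (F p)" "card (F p) = j" using X by auto
    show "(\<Sum>E\<in>{E \<in> ?G. F p \<subseteq> E}. 1) \<le> q ^ j * real (card ?G)"
      using card_containing_le[OF F(1,2) _ k] F(3) X(3) q(1) by simp
  qed
  also have "\<dots> = real (card X) * q ^ j * real (card ?G)" by simp
  also have "\<dots> \<le> real n ^ j * q ^ j * real (card ?G)"
    using c q0 by (intro mult_right_mono) (auto simp flip: of_nat_power)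
  also have "\<dots> = (q * n) ^ j * real (card ?G)" by (simp add: power_mult_distrib)
  also have "\<dots> \<le> (2 * real r) ^ j * real (card ?G)"
    using q(2) mult_nonneg_nonneg[OF q0, of "real n"] by (intro mult_right_mono power_mono) simp_all
  finally show ?thesis .
qed

lemma sum_card_triangles_le:
  assumes k: "k = real r * real n - 2 * real 4 - 2 * real r * (real r + 1)" "k > 0"
    and q: "q = (real r)\<^sup>2 / k" "q * real n \<le> 2 * real r"
  shows "(\<Sum>E\<in>regular_graphs r n. real (card (triangles E)))
           \<le> (2 * real r) ^ 3 * real (card (regular_graphs r n))"
proof -
  define X where "X = {((u, w), v). u \<noteq> w \<and> u \<noteq> v \<and> v \<noteq> w} \<inter> ({1..n} \<times> {1..n}) \<times> {1..n}"
  \<comment> \<open>The edges are oriented cyclically, which makes \<open>F p\<close> asymmetric as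
    soon as the vertices are distinct.\<close>
  define F :: "(nat \<times> nat) \<times> nat \<Rightarrow> (nat \<times> nat) set"
    where "F = (\<lambda>((u, w), v). {(w, u), (u, v), (v, w)})"
  have "card X \<le> card (({1..n} \<times> {1..n}) \<times> {1..n})" by (rule card_mono) (auto simp: X_def)
  then have c: "card X \<le> n ^ 3" by (simp add: power3_eq_cube)
  have "triangles E = {p \<in> X. F p \<subseteq> E}" if "E \<in> regular_graphs r n" for E
    using regular_graphsD(1,3,4)[OF that]
    by (auto simp: triangles_def X_def F_def sym_def irrefl_def)
  then have "(\<Sum>E\<in>regular_graphs r n. real (card (triangles E))) =
      (\<Sum>E\<in>regular_graphs r n. real (card {p \<in> X. F p \<subseteq> E}))" by simp
  also have "\<dots> \<le> (2 * real r) ^ 3 * real (card (regular_graphs r n))"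
    by (rule sum_card_copies_le[OF _ _ _ k q c])
      (auto simp: X_def F_def asym_on_def card_insert_if)
  finally show ?thesis .
qed

lemma sum_card_squares_le:
  assumes k: "k = real r * real n - 2 * real 4 - 2 * real r * (real r + 1)" "k > 0"
    and q: "q = (real r)\<^sup>2 / k" "q * real n \<le> 2 * real r"
  shows "(\<Sum>E\<in>regular_graphs r n. real (card (squares E)))
           \<le> (2 * real r) ^ 4 * real (card (regular_graphs r n))"
proof -
  define X where "X = {((u, w), (v, z)). u \<noteq> w \<and> v \<noteq> z \<and> u \<noteq> v \<and> v \<noteq> w \<and> u \<noteq> z \<and> z \<noteq> w}
    \<inter> ({1..n} \<times> {1..n}) \<times> ({1..n} \<times> {1..n})"
  define F :: "(nat \<times> nat) \<times> (nat \<times> nat) \<Rightarrow> (nat \<times> nat) set"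
    where "F = (\<lambda>((u, w), (v, z)). {(u, v), (v, w), (w, z), (z, u)})"
  have "card X \<le> card (({1..n} \<times> {1..n}) \<times> ({1..n} \<times> {1..n}))"
    by (rule card_mono) (auto simp: X_def)
  then have c: "card X \<le> n ^ 4" by (simp add: power4_eq_xxxx mult.assoc)
  have "squares E = {p \<in> X. F p \<subseteq> E}" if "E \<in> regular_graphs r n" for E
    using regular_graphsD(1,3,4)[OF that]
    by (auto simp: squares_def X_def F_def sym_def irrefl_def)
  then have "(\<Sum>E\<in>regular_graphs r n. real (card (squares E))) =
      (\<Sum>E\<in>regular_graphs r n. real (card {p \<in> X. F p \<subseteq> E}))" by simp
  also have "\<dots> \<le> (2 * real r) ^ 4 * real (card (regular_graphs r n))"
    by (rule sum_card_copies_le[OF _ _ _ k q c])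
      (auto simp: X_def F_def asym_on_def card_insert_if)
  finally show ?thesis .
qed

section \<open>Pairs at distance two across a bisection\<close>

definition second_cut :: "nat \<Rightarrow> (nat \<times> nat) set \<Rightarrow> nat set \<Rightarrow> (nat \<times> nat) set" where
  "second_cut n E A =
     {(u, w). u \<in> A \<and> w \<in> {1..n} - A \<and> (u, w) \<notin> E \<and> (\<exists>v. (u, v) \<in> E \<and> (v, w) \<in> E)}"

lemma card_off_diagonal:
  assumes "finite C"
  shows "card {(v, z). v \<in> C \<and> z \<in> C \<and> v \<noteq> z} = card C * card C - card C"
proof -
  have "{(v, z). v \<in> C \<and> z \<in> C \<and> v \<noteq> z} = C \<times> C - (\<lambda>v. (v, v)) ` C" by auto
  moreover have "card ((\<lambda>v. (v, v)) ` C) = card C" by (rule card_image) (auto simp: inj_on_def)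
  ultimately show ?thesis
    using assms by (simp only:) (subst card_Diff_subset, auto simp: card_cartesian_product)
qed

text \<open>A cut pair joined by \<open>c\<close> paths of length 2 is counted once by \<open>second_cut\<close> if it is not an edge;
  \<open>c \<le> 1 + (c\<^sup>2 - c)\<close> charges the surplus to 4-cycles, and edges are charged to triangles.\<close>

lemma sum_split_degrees_le:
  assumes E: "E \<in> regular_graphs r n" and A: "A \<subseteq> {1..n}"
  shows "(\<Sum>v\<in>{1..n}. card (E `` {v} \<inter> A) * card (E `` {v} - A))
           \<le> card (second_cut n E A) + card (triangles E) + card (squares E)"
proof -
  note D = regular_graphsD[OF E]
  have sym: "(b, a) \<in> E" if "(a, b) \<in> E" for a b using D(3) that by (auto simp: sym_def)
  have V: "a \<in> {1..n}" "b \<in> {1..n}" if "(a, b) \<in> E" for a b using D(1) that by auto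
  define B where "B = {1..n} - A"
  define C where "C p = E `` {fst p} \<inter> E `` {snd p}" for p
  have fin: "finite A" "finite B" using A finite_subset by (auto simp: B_def)
  have finC: "finite (C p)" for p using D(6) by (simp add: C_def)
  have "(\<Sum>v\<in>{1..n}. card (E `` {v} \<inter> A) * card (E `` {v} - A)) =
      card (SIGMA v:{1..n}. (E `` {v} \<inter> A) \<times> (E `` {v} - A))"
    using D(6) by (simp add: card_cartesian_product)
  also have "\<dots> = card (prod.swap ` (SIGMA v:{1..n}. (E `` {v} \<inter> A) \<times> (E `` {v} - A)))"
    by (simp add: card_image)
  \<comment> \<open>The paths of length 2 across the cut, so far listed by their midpoint, are
    listed by their endpoints from here on; \<open>C\<close> collects the midpoints.\<close>
  also have "prod.swap ` (SIGMA v:{1..n}. (E `` {v} \<inter> A) \<times> (E `` {v} - A)) = Sigma (A \<times> B) C"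
    using V sym by (fastforce simp: B_def C_def image_iff)
  also have "card \<dots> = (\<Sum>p\<in>A \<times> B. card (C p))" using fin finC by simp
  also have "\<dots> \<le> (\<Sum>p\<in>A \<times> B. (if p \<in> second_cut n E A then 1 else 0) +
      (if p \<in> E then card (C p) else 0) + (card (C p) * card (C p) - card (C p)))"
  proof (rule sum_mono)
    fix p assume p: "p \<in> A \<times> B"
    show "card (C p) \<le> (if p \<in> second_cut n E A then 1 else 0) +
      (if p \<in> E then card (C p) else 0) + (card (C p) * card (C p) - card (C p))"
    proof (cases "p \<in> E \<or> C p = {}")
      case False
      then have "p \<in> second_cut n E A"
        using p sym by (cases p) (fastforce simp: second_cut_def B_def C_def)
      moreover have "c \<le> 1 + (c * c - c)" for c :: nat by (cases c) auto
      ultimately show ?thesis using False by simp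
    next
      case True
      have le: "c \<le> x + c + y" for c x y :: nat by simp
      show ?thesis
      proof (cases "p \<in> E")
        case True
        show ?thesis unfolding if_P[OF True] by (rule le)
      qed (use True in simp)
    qed
  qed
  also have "\<dots> = (\<Sum>p\<in>A \<times> B. if p \<in> second_cut n E A then 1 else 0) +
      (\<Sum>p\<in>A \<times> B. if p \<in> E then card (C p) else 0) +
      (\<Sum>p\<in>A \<times> B. card (C p) * card (C p) - card (C p))"
    by (simp only: sum.distrib)
  also have "(\<Sum>p\<in>A \<times> B. if p \<in> second_cut n E A then 1 else 0) = card (second_cut n E A)"
  proof -
    have "second_cut n E A \<subseteq> A \<times> B" by (auto simp: second_cut_def B_def)
    then have "{p \<in> A \<times> B. p \<in> second_cut n E A} = second_cut n E A" by auto
    then show ?thesis using fin by (simp flip: sum.inter_filter)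
  qed
  also have "(\<Sum>p\<in>A \<times> B. if p \<in> E then card (C p) else 0) \<le> card (triangles E)"
  proof -
    have "(\<Sum>p\<in>A \<times> B. if p \<in> E then card (C p) else 0) = (\<Sum>p\<in>{p \<in> A \<times> B. p \<in> E}. card (C p))"
      using fin by (simp flip: sum.inter_filter)
    also have "\<dots> \<le> (\<Sum>p\<in>E. card (C p))" using D(2) by (intro sum_mono2) auto
    also have "\<dots> = card (Sigma E C)" using D(2) finC by simp
    also have "Sigma E C = triangles E" using sym by (auto simp: triangles_def C_def)
    finally show ?thesis .
  qed
  also have "(\<Sum>p\<in>A \<times> B. card (C p) * card (C p) - card (C p)) \<le> card (squares E)"
  proof -
    let ?O = "\<lambda>p. {(v, z). v \<in> C p \<and> z \<in> C p \<and> v \<noteq> z}"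
    have finO: "finite (?O p)" for p by (rule finite_subset[of _ "C p \<times> C p"]) (auto simp: finC)
    have "(\<Sum>p\<in>A \<times> B. card (C p) * card (C p) - card (C p)) = (\<Sum>p\<in>A \<times> B. card (?O p))"
      by (simp add: card_off_diagonal finC)
    also have "\<dots> = card (Sigma (A \<times> B) ?O)"
      using fin finO by (intro card_SigmaI[symmetric]) auto
    also have "\<dots> \<le> card (squares E)"
    proof (rule card_mono)
      have "squares E \<subseteq> ({1..n} \<times> {1..n}) \<times> ({1..n} \<times> {1..n})"
        using V by (auto simp: squares_def)
      then show "finite (squares E)" by (rule finite_subset) auto
      show "Sigma (A \<times> B) ?O \<subseteq> squares E"
        using sym by (auto simp: squares_def C_def B_def)
    qed
    finally show ?thesis .
  qed
  finally show ?thesis by simp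
qed

text \<open>Fewer than \<open>s\<close> vertices have \<open>(1/2 + 6 * \<epsilon>) * r\<close> or
  more neighbours on a given side, since otherwise they would witness discrepancy. Hence at least
  \<open>n * (1 - 3 * \<epsilon>)\<close> vertices split their neighbourhood almost evenly and are
  midpoints of at least \<open>(1/4 - 36 * \<epsilon> ^ 2) * r ^ 2\<close> paths across the cut. The
  last \<open>\<epsilon> * r ^ 2 * n\<close> of the loss pays for the short cycles.\<close>

lemma card_second_cut_ge:
  fixes \<epsilon> q :: real
  assumes E: "E \<in> regular_graphs r n" and A: "A \<subseteq> {1..n}" "card A = n div 2"
    and disc: "\<not> discrepant r n s q \<epsilon> E" and s: "real s \<le> \<epsilon> * n + 1"
    and q: "q * n \<le> (1 + 6 * \<epsilon>) * r" "0 \<le> q"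
    and \<epsilon>: "0 < \<epsilon>" "\<epsilon> \<le> 1/12" "2 \<le> \<epsilon> * n"
    and cycles: "real (card (triangles E) + card (squares E)) \<le> \<epsilon> * (real r)\<^sup>2 * n"
  shows "(1/4 - 5 * \<epsilon>) * (real r)\<^sup>2 * n \<le> real (card (second_cut n E A))"
proof -
  note D = regular_graphsD[OF E]
  define B where "B = {1..n} - A"
  define U where "U X = {v \<in> {1..n}. (1/2 + 6 * \<epsilon>) * r \<le> real (card (E `` {v} \<inter> X))}" for X
  have finA: "finite A" using A finite_subset by auto
  have n: "1 / real n \<le> \<epsilon> / 2" "n > 0"
  proof -
    show "n > 0" using \<epsilon> by (cases n) auto
    then show "1 / real n \<le> \<epsilon> / 2" using \<epsilon> by (simp add: field_simps)
  qed
  have U: "card (U X) < s" if X: "X \<subseteq> {1..n}" "2 * card X \<le> n + 1" for X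
  proof (rule ccontr)
    assume "\<not> card (U X) < s"
    then obtain S where S: "S \<subseteq> U X" "card S = s" by (metis not_less obtain_subset_with_card_n)
    have finS: "finite S" using S(1) by (rule finite_subset) (simp add: U_def)
    have "(\<Sum>v\<in>S. card (E `` {v} \<inter> X)) = card (SIGMA v:S. E `` {v} \<inter> X)"
      using finS D(6) by simp
    also have "(SIGMA v:S. E `` {v} \<inter> X) = E \<inter> S \<times> X" by auto
    finally have eq: "real (card (E \<inter> S \<times> X)) = (\<Sum>v\<in>S. real (card (E `` {v} \<inter> X)))"
      unfolding of_nat_sum[symmetric] by (rule arg_cong[OF sym])
    \<comment> \<open>The \<open>n + 1\<close> covers odd \<open>n\<close>, where the larger half
      has \<open>(n + 1) / 2\<close> vertices. The typical share is at most
      \<open>1/2 + 4 * \<epsilon>\<close>; the remaining \<open>2 * \<epsilon>\<close> is the slack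
      in \<open>discrepant\<close>.\<close>
    have "q * card X \<le> q * ((n + 1) / 2)" using X(2) q(2) by (intro mult_left_mono) auto
    also have "\<dots> = (q * n) * (1/2 + 1 / n / 2)" using n(2) by (simp add: field_simps)
    also have "\<dots> \<le> ((1 + 6 * \<epsilon>) * r) * (1/2 + \<epsilon> / 4)"
      using q n \<epsilon> by (intro mult_mono[OF q(1)]) auto
    also have "\<dots> = r * (1/2 + 3 * \<epsilon> + \<epsilon> / 4 + 3/2 * \<epsilon> * \<epsilon>)" by (simp add: field_simps)
    also have "\<dots> \<le> r * (1/2 + 3 * \<epsilon> + \<epsilon> / 4 + 3/2 * \<epsilon> * (1/12))"
      using \<epsilon> by (intro mult_left_mono add_left_mono) auto
    also have "\<dots> \<le> r * (1/2 + 4 * \<epsilon>)" using \<epsilon> by (intro mult_left_mono) auto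
    finally have "q * card X \<le> r * (1/2 + 4 * \<epsilon>)" .
    then have "q * card X * s \<le> r * (1/2 + 4 * \<epsilon>) * s" by (intro mult_right_mono) auto
    then have "q * real s * real (card X) + 2 * \<epsilon> * real r * real s \<le> s * ((1/2 + 6 * \<epsilon>) * r)"
      by (simp add: algebra_simps)
    also have "\<dots> = (\<Sum>v\<in>S. (1/2 + 6 * \<epsilon>) * r)" using S by simp
    also have "\<dots> \<le> real (card (E \<inter> S \<times> X))"
      unfolding eq using S by (intro sum_mono) (auto simp: U_def)
    finally have "q * real s * real (card X) + 2 * \<epsilon> * real r * real s \<le> real (card (E \<inter> S \<times> X))" .
    moreover have "S \<subseteq> {1..n}" using S by (auto simp: U_def)
    ultimately show False using disc X S unfolding discrepant_def by blast
  qed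
  have cB: "card B = n - n div 2" using A finA by (simp add: B_def card_Diff_subset)
  have UA: "card (U A) < s" using A by (intro U) auto
  have UB: "card (U B) < s" using cB by (intro U) (auto simp: B_def)
  define W where "W = {1..n} - (U A \<union> U B)"
  have "n - (card (U A) + card (U B)) \<le> card W"
  proof -
    have "card (U A \<union> U B) \<le> card (U A) + card (U B)" by (rule card_Un_le)
    moreover have "card W = n - card (U A \<union> U B)"
      unfolding W_def by (subst card_Diff_subset) (auto simp: U_def)
    ultimately show ?thesis by linarith
  qed
  then have "real n - 2 * real s \<le> real (card W)" using UA UB by linarith
  then have W: "n * (1 - 3 * \<epsilon>) \<le> real (card W)" using s \<epsilon> by (simp add: algebra_simps)
  have split: "(1/4 - 36 * \<epsilon>\<^sup>2) * (real r)\<^sup>2 \<le> real (card (E `` {v} \<inter> A) * card (E `` {v} - A))"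
    if v: "v \<in> W" for v
  proof -
    have "E `` {v} - A = E `` {v} \<inter> B" using D(1) by (auto simp: B_def)
    define a where "a = real (card (E `` {v} \<inter> A))"
    define b where "b = real (card (E `` {v} - A))"
    have "card (E `` {v} \<inter> A) + card (E `` {v} - A) = card (E `` {v})"
      using D(6) by (subst card_Un_disjoint[symmetric]) (auto intro: arg_cong[where f = card])
    then have ab: "a + b = r" using v D(5) by (simp add: a_def b_def W_def flip: of_nat_add)
    have "a \<le> (1/2 + 6 * \<epsilon>) * r" "b \<le> (1/2 + 6 * \<epsilon>) * r"
      using v by (auto simp: W_def U_def a_def b_def \<open>E `` {v} - A = E `` {v} \<inter> B\<close>)
    then have "\<bar>a - b\<bar> \<le> 12 * \<epsilon> * r" using ab by (simp add: algebra_simps abs_le_iff)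
    then have "(a - b)\<^sup>2 \<le> (12 * \<epsilon> * r)\<^sup>2" using power_mono[of "\<bar>a - b\<bar>" _ 2] by simp
    moreover have "4 * (a * b) = (a + b)\<^sup>2 - (a - b)\<^sup>2" by (simp add: power2_eq_square algebra_simps)
    ultimately have "(real r)\<^sup>2 - (12 * \<epsilon> * r)\<^sup>2 \<le> 4 * (a * b)" using ab by simp
    then show ?thesis by (simp add: a_def b_def power_mult_distrib algebra_simps)
  qed
  have e2: "36 * \<epsilon>\<^sup>2 \<le> 3 * \<epsilon>"
    using \<epsilon> mult_left_mono[of \<epsilon> "1/12" \<epsilon>] by (simp add: power2_eq_square)
  have "(1/4 - 4 * \<epsilon>) * (real r)\<^sup>2 * n \<le> (1/4 - 36 * \<epsilon>\<^sup>2) * (real r)\<^sup>2 * (n * (1 - 3 * \<epsilon>))"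
  proof -
    have "1/4 - 4 * \<epsilon> \<le> (1/4 - 3 * \<epsilon>) * (1 - 3 * \<epsilon>)"
      using \<epsilon> by (simp add: algebra_simps)
    also have "\<dots> \<le> (1/4 - 36 * \<epsilon>\<^sup>2) * (1 - 3 * \<epsilon>)"
      using e2 \<epsilon> by (intro mult_right_mono) auto
    finally have "(1/4 - 4 * \<epsilon>) * ((real r)\<^sup>2 * n) \<le> (1/4 - 36 * \<epsilon>\<^sup>2) * (1 - 3 * \<epsilon>) * ((real r)\<^sup>2 * n)"
      by (intro mult_right_mono) auto
    then show ?thesis by (simp add: mult_ac)
  qed
  also have "\<dots> \<le> (1/4 - 36 * \<epsilon>\<^sup>2) * (real r)\<^sup>2 * real (card W)"
    using W e2 \<epsilon> by (intro mult_left_mono) auto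
  also have "\<dots> = (\<Sum>v\<in>W. (1/4 - 36 * \<epsilon>\<^sup>2) * (real r)\<^sup>2)" by simp
  also have "\<dots> \<le> (\<Sum>v\<in>W. real (card (E `` {v} \<inter> A) * card (E `` {v} - A)))"
    by (intro sum_mono split)
  also have "\<dots> \<le> (\<Sum>v\<in>{1..n}. real (card (E `` {v} \<inter> A) * card (E `` {v} - A)))"
    by (intro sum_mono2) (auto simp: W_def)
  also have "\<dots> \<le> real (card (second_cut n E A) + card (triangles E) + card (squares E))"
    unfolding of_nat_sum[symmetric] of_nat_le_iff by (rule sum_split_degrees_le[OF E A(1)])
  finally show ?thesis using cycles by (simp add: algebra_simps)
qed

definition sparse_cut :: "nat \<Rightarrow> nat \<Rightarrow> real \<Rightarrow> (nat \<times> nat) set \<Rightarrow> bool" where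
  "sparse_cut r n \<epsilon> E \<longleftrightarrow> (\<exists>A. A \<subseteq> {1..n} \<and> card A = n div 2 \<and>
     real (card (second_cut n E A)) < (1/4 - 5 * \<epsilon>) * (real r)\<^sup>2 * n)"

text \<open>Markov's inequality. It is applied with \<open>c\<close> linear in \<open>n\<close>, so
  the fraction of exceptional graphs is of order \<open>1 / n\<close>.\<close>

lemma many_short_cycles_le:
  assumes k: "k = real r * real n - 2 * real 4 - 2 * real r * (real r + 1)" "k > 0"
    and q: "q = (real r)\<^sup>2 / k" "q * real n \<le> 2 * real r"
    and c: "c > 0"
  shows "real (card {E \<in> regular_graphs r n. c < real (card (triangles E) + card (squares E))})
           \<le> ((2 * real r) ^ 3 + (2 * real r) ^ 4) / c * real (card (regular_graphs r n))"
proof -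
  let ?G = "regular_graphs r n"
  let ?M = "{E \<in> ?G. c < real (card (triangles E) + card (squares E))}"
  have "real (card ?M) * c = (\<Sum>E\<in>?M. c)" by simp
  also have "\<dots> \<le> (\<Sum>E\<in>?M. real (card (triangles E) + card (squares E)))"
    by (intro sum_mono) auto
  also have "\<dots> \<le> (\<Sum>E\<in>?G. real (card (triangles E) + card (squares E)))"
    using finite_regular_graphs by (intro sum_mono2) auto
  also have "\<dots> = (\<Sum>E\<in>?G. real (card (triangles E))) + (\<Sum>E\<in>?G. real (card (squares E)))"
    by (simp add: sum.distrib)
  also have "\<dots> \<le> (2 * real r) ^ 3 * real (card ?G) + (2 * real r) ^ 4 * real (card ?G)"
    by (intro add_mono sum_card_triangles_le[OF k q] sum_card_squares_le[OF k q])
  finally show ?thesis using c by (simp add: field_simps)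
qed

text \<open>A sparse bisection forces discrepancy or many short cycles, and the two use different
  values of \<open>q\<close>. Discrepancy involves up to \<open>s * r\<close> edges, and
  \<open>q * n\<close> must be within a factor \<open>1 + 6 * \<epsilon>\<close> of \<open>r\<close>
  because the leading constant \<open>1/4\<close> rests on it; for the cycles, with at most 4 edges,
  a factor 2 suffices.\<close>

lemma sparse_cut_le:
  fixes \<epsilon> :: real
  assumes r: "r \<ge> 1" and \<epsilon>: "0 < \<epsilon>" "\<epsilon> \<le> 1/12" "24 \<le> real r * \<epsilon> ^ 3"
    and n: "2 * real r + 6 \<le> \<epsilon> * n" "4 * real r + 20 \<le> n"
  shows "real (card {E \<in> regular_graphs r n. sparse_cut r n \<epsilon> E})
    \<le> (2 * (1 / 2) ^ n + ((2 * real r) ^ 3 + (2 * real r) ^ 4) / (\<epsilon> * (real r)\<^sup>2 * n))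
       * real (card (regular_graphs r n))"
proof -
  let ?G = "regular_graphs r n"
  define s where "s = nat \<lceil>\<epsilon> * n\<rceil>"
  have "0 \<le> \<epsilon> * n" using \<epsilon> by simp
  then have s: "\<epsilon> * n \<le> real s" "real s \<le> \<epsilon> * n + 1" unfolding s_def by linarith+
  define k where "k = real r * real n - 2 * real (s * r) - 2 * real r * (real r + 1)"
  define q where "q = (real r)\<^sup>2 / k"
  have "real r * (n * (1 - 3 * \<epsilon>)) \<le> real r * (n - 2 * real s - 2 * (real r + 1))"
    using s n by (intro mult_left_mono) (auto simp: algebra_simps)
  also have "\<dots> = k" by (simp add: k_def algebra_simps)
  finally have k_ge: "real r * (n * (1 - 3 * \<epsilon>)) \<le> k" .
  have pos: "0 < real r * (n * (1 - 3 * \<epsilon>))" using r n \<epsilon> by (intro mult_pos_pos) auto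
  then have k: "k > 0" using k_ge by linarith
  have "q * n \<le> (real r)\<^sup>2 / (real r * (n * (1 - 3 * \<epsilon>))) * n"
    unfolding q_def by (intro mult_right_mono divide_left_mono[OF k_ge _ mult_pos_pos[OF k pos]]) auto
  also have "\<dots> = real r / (1 - 3 * \<epsilon>)" using r n \<epsilon> by (simp add: field_simps power2_eq_square)
  also have "\<dots> \<le> (1 + 6 * \<epsilon>) * real r"
  proof -
    have "\<epsilon> * \<epsilon> \<le> \<epsilon> * (1/12)" using \<epsilon> by (intro mult_left_mono) auto
    then have "1 \<le> (1 + 6 * \<epsilon>) * (1 - 3 * \<epsilon>)" using \<epsilon> by (simp add: algebra_simps)
    then have "real r * 1 \<le> real r * ((1 + 6 * \<epsilon>) * (1 - 3 * \<epsilon>))" by (intro mult_left_mono) auto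
    then show ?thesis using \<epsilon> by (simp add: pos_divide_le_eq mult_ac)
  qed
  finally have qn: "q * n \<le> (1 + 6 * \<epsilon>) * real r" .
  have "(1 + 6 * \<epsilon>) * real r \<le> 2 * real r" using \<epsilon> by (intro mult_right_mono) auto
  then have qn2: "q * real n \<le> 2 * real r" using qn by linarith
  define k4 where "k4 = real r * real n - 2 * real 4 - 2 * real r * (real r + 1)"
  define q4 where "q4 = (real r)\<^sup>2 / k4"
  have k4_ge: "real r * n / 2 \<le> k4"
  proof -
    have "real r * (4 * real r + 20) \<le> real r * n" using n by (intro mult_left_mono) auto
    then show ?thesis using r by (simp add: k4_def algebra_simps)
  qed
  have pos4: "0 < real r * n / 2" using r n by simp
  then have k4: "k4 > 0" using k4_ge by linarith
  have q4_le: "q4 \<le> (real r)\<^sup>2 / (real r * n / 2)"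
    unfolding q4_def by (intro divide_left_mono[OF k4_ge _ mult_pos_pos[OF k4 pos4]]) simp
  have "q4 * n \<le> (real r)\<^sup>2 / (real r * n / 2) * n" using q4_le by (intro mult_right_mono) auto
  also have "\<dots> = 2 * real r" using r n by (simp add: field_simps power2_eq_square)
  finally have q4: "q4 * real n \<le> 2 * real r" .
  define D where "D = {E \<in> ?G. discrepant r n s q \<epsilon> E}"
  define M where "M = {E \<in> ?G. \<epsilon> * (real r)\<^sup>2 * n < real (card (triangles E) + card (squares E))}"
  have "{E \<in> ?G. sparse_cut r n \<epsilon> E} \<subseteq> D \<union> M"
  proof
    fix E assume E: "E \<in> {E \<in> ?G. sparse_cut r n \<epsilon> E}"
    then obtain A where A: "A \<subseteq> {1..n}" "card A = n div 2"
      "real (card (second_cut n E A)) < (1/4 - 5 * \<epsilon>) * (real r)\<^sup>2 * n"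
      unfolding sparse_cut_def by auto
    show "E \<in> D \<union> M"
    proof (rule ccontr)
      assume "E \<notin> D \<union> M"
      then have "\<not> discrepant r n s q \<epsilon> E"
        "real (card (triangles E) + card (squares E)) \<le> \<epsilon> * (real r)\<^sup>2 * n"
        using E by (auto simp: D_def M_def)
      then have "(1/4 - 5 * \<epsilon>) * (real r)\<^sup>2 * n \<le> real (card (second_cut n E A))"
        using E A k n by (intro card_second_cut_ge[OF _ _ _ _ s(2) qn _ \<epsilon>(1,2)]) (auto simp: q_def)
      then show False using A by simp
    qed
  qed
  moreover have "finite (D \<union> M)" using finite_regular_graphs by (auto simp: D_def M_def)
  ultimately have "card {E \<in> ?G. sparse_cut r n \<epsilon> E} \<le> card (D \<union> M)" by (intro card_mono)
  also have "\<dots> \<le> card D + card M" by (rule card_Un_le)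
  finally have "real (card {E \<in> ?G. sparse_cut r n \<epsilon> E}) \<le> real (card D) + real (card M)" by linarith
  also have "real (card D) \<le> 2 * (1 / 2) ^ n * real (card ?G)"
    unfolding D_def using \<epsilon> s by (intro discrepant_le[OF k_def k q_def qn2]) auto
  also have "real (card M) \<le> ((2 * real r) ^ 3 + (2 * real r) ^ 4) / (\<epsilon> * (real r)\<^sup>2 * n)
       * real (card ?G)"
    unfolding M_def using r \<epsilon> n
    by (intro many_short_cycles_le[OF k4_def k4 q4_def q4]) (auto intro!: mult_pos_pos)
  finally show ?thesis by (simp add: algebra_simps)
qed

section \<open>Existence of regular graphs\<close>

lemma regular_graphs_nonempty:
  assumes "r < n" "even (n * r)"
  shows "regular_graphs r n \<noteq> {}"
proof -
  \<comment> \<open>a circulant graph with the \<open>r div 2\<close> nearest vertices on either side, and the antipode for odd \<open>r\<close>\<close>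
  define D where "D = {d \<in> {1..<n}. d \<le> r div 2 \<or> n - d \<le> r div 2 \<or> (odd r \<and> 2 * d = n)}"
  define E where "E = {(x, y). x \<in> {1..n} \<and> y \<in> {1..n} \<and> (if x < y then y - x \<in> D else x - y \<in> D)}"
  have Dsym: "n - d \<in> D" if "d \<in> D" for d using that by (auto simp: D_def)
  have D0: "0 \<notin> D" "n \<notin> D" by (auto simp: D_def)
  have "card D = r"
  proof (cases "even r")
    case True
    then obtain h where h: "r = 2 * h" by (rule evenE)
    have "D = {1..h} \<union> {n - h..<n}" using assms h by (auto simp: D_def)
    also have "card \<dots> = card {1..h} + card {n - h..<n}"
      using assms h by (intro card_Un_disjoint) auto
    finally show ?thesis using assms h by simp
  next
    case False
    then obtain h where h: "r = 2 * h + 1" by (rule oddE)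
    obtain m where m: "n = 2 * m" using assms False by auto
    have "D = insert m ({1..h} \<union> {n - h..<n})" using assms h m by (auto simp: D_def)
    also have "card \<dots> = Suc (card ({1..h} \<union> {n - h..<n}))"
      using assms h m by (intro card_insert_disjoint) auto
    also have "card ({1..h} \<union> {n - h..<n}) = card {1..h} + card {n - h..<n}"
      using assms h by (intro card_Un_disjoint) auto
    finally show ?thesis using assms h m by simp
  qed
  have "card (E `` {x}) = r" if x: "x \<in> {1..n}" for x
  proof -
    \<comment> \<open>\<open>d\<close> is a forward step around the cycle. If it wraps, the plain
      difference of the endpoints is \<open>n - d\<close>, which lies in \<open>D\<close> by
      \<open>Dsym\<close>.\<close>
    have "bij_betw (\<lambda>d. if x + d \<le> n then x + d else x + d - n) D (E `` {x})"
    proof (rule bij_betwI[where g = "\<lambda>y. if x < y then y - x else n - (x - y)"])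
      show "(\<lambda>d. if x + d \<le> n then x + d else x + d - n) \<in> D \<rightarrow> E `` {x}"
        using x Dsym by (force simp: E_def D_def)
      show "(\<lambda>y. if x < y then y - x else n - (x - y)) \<in> E `` {x} \<rightarrow> D"
      proof
        fix y assume "y \<in> E `` {x}"
        then have "if x < y then y - x \<in> D else x - y \<in> D" by (simp add: E_def)
        then show "(if x < y then y - x else n - (x - y)) \<in> D"
          by (cases "x < y") (simp_all only: if_True if_False Dsym)
      qed
    qed (use x in \<open>auto simp: D_def E_def\<close>)
    then show ?thesis using \<open>card D = r\<close> bij_betw_same_card by metis
  qed
  moreover have "irrefl E" "sym E" using D0 by (auto simp: E_def irrefl_def sym_def)
  moreover have "E \<subseteq> {1..n} \<times> {1..n}" by (auto simp: E_def)
  ultimately have "E \<in> regular_graphs r n" by (simp add: regular_graphs_def)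
  then show ?thesis by auto
qed

section \<open>Distances in connected regular graphs\<close>

lemma graph_dist_le: "(x, y) \<in> E ^^ k \<Longrightarrow> graph_dist E x y \<le> k"
  unfolding graph_dist_def by (rule Least_le)

lemma relpow_sym:
  assumes "sym E" "(x, y) \<in> E ^^ k"
  shows "(y, x) \<in> E ^^ k"
  using assms(2)
proof (induction k arbitrary: y)
  case (Suc k)
  then obtain z where "(x, z) \<in> E ^^ k" "(z, y) \<in> E" by auto
  then show ?case using Suc.IH assms(1) by (meson relpow_Suc_I2 symD)
qed auto

lemma graph_dist_sym: "sym E \<Longrightarrow> graph_dist E x y = graph_dist E y x"
  unfolding graph_dist_def using relpow_sym by metis

text \<open>Connectedness makes \<open>graph_dist\<close> the length of an actual walk and rules out
  the arbitrary values of \<open>LEAST\<close>.\<close>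

locale connected_regular_graph =
  fixes r n :: nat and E :: "(nat \<times> nat) set"
  assumes regular: "E \<in> regular_graphs r n"
    and connected: "\<And>x y. x \<in> {1..n} \<Longrightarrow> y \<in> {1..n} \<Longrightarrow> \<exists>k. (x, y) \<in> E ^^ k"
begin

lemmas E_sub = regular_graphsD(1)[OF regular]
  and finite_E = regular_graphsD(2)[OF regular]
  and sym_E = regular_graphsD(3)[OF regular]
  and irrefl_E = regular_graphsD(4)[OF regular]
  and finite_nbhd = regular_graphsD(6)[OF regular]
  and card_nbhd_le = regular_graphsD(7)[OF regular]

lemma edge_sym: "(x, y) \<in> E \<Longrightarrow> (y, x) \<in> E"
  using sym_E by (rule symD)

lemma geodesic: "x \<in> {1..n} \<Longrightarrow> y \<in> {1..n} \<Longrightarrow> (x, y) \<in> E ^^ graph_dist E x y"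
  unfolding graph_dist_def using connected by (rule LeastI_ex)

lemma graph_dist_eq_0_iff: "x \<in> {1..n} \<Longrightarrow> y \<in> {1..n} \<Longrightarrow> graph_dist E x y = 0 \<longleftrightarrow> x = y"
  using geodesic[of x y] graph_dist_le[where x = x and y = y and E = E and k = 0] by auto

lemma graph_dist_edge:
  assumes "(x, y) \<in> E"
  shows "graph_dist E x y = 1"
proof -
  have "x \<in> {1..n}" "y \<in> {1..n}" "x \<noteq> y" using assms E_sub irrefl_E by (auto simp: irrefl_def)
  then have "graph_dist E x y \<noteq> 0" by (simp add: graph_dist_eq_0_iff)
  moreover have "graph_dist E x y \<le> 1" using assms by (intro graph_dist_le) simp
  ultimately show ?thesis by simp
qed

lemma graph_dist_second_cut:
  assumes "A \<subseteq> {1..n}" "(x, y) \<in> second_cut n E A"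
  shows "graph_dist E x y = 2"
proof -
  obtain z where z: "x \<in> {1..n}" "y \<in> {1..n}" "x \<noteq> y" "(x, y) \<notin> E" "(x, z) \<in> E" "(z, y) \<in> E"
    using assms unfolding second_cut_def by blast
  then have "graph_dist E x y \<noteq> 0" by (simp add: graph_dist_eq_0_iff)
  moreover have "graph_dist E x y \<noteq> Suc 0" using geodesic[OF z(1,2)] z(4) by auto
  moreover have "(x, y) \<in> E ^^ Suc (Suc 0)" using z by auto
  then have "graph_dist E x y \<le> Suc (Suc 0)" by (rule graph_dist_le)
  ultimately show ?thesis by linarith
qed

lemma graph_dist_step:
  assumes "x \<in> {1..n}" "(y, z) \<in> E"
  shows "graph_dist E x z \<le> Suc (graph_dist E x y)"
proof -
  have "y \<in> {1..n}" using assms E_sub by auto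
  then have "(x, z) \<in> E ^^ Suc (graph_dist E x y)"
    using geodesic[OF assms(1)] assms(2) by (meson relpow_Suc_I)
  then show ?thesis by (rule graph_dist_le)
qed

lemma graph_dist_predecessor:
  assumes "x \<in> {1..n}" "z \<in> {1..n}" "graph_dist E x z = Suc i"
  obtains y where "y \<in> {1..n}" "(y, z) \<in> E" "graph_dist E x y = i"
proof -
  have "(x, z) \<in> E ^^ Suc i" using geodesic[OF assms(1,2)] assms(3) by simp
  then obtain y where y: "(x, y) \<in> E ^^ i" "(y, z) \<in> E" by auto
  have "graph_dist E x y \<le> i" using y(1) by (rule graph_dist_le)
  moreover have "Suc i \<le> Suc (graph_dist E x y)"
    using graph_dist_step[OF assms(1) y(2)] assms(3) by simp
  moreover have "y \<in> {1..n}" using y(2) E_sub by auto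
  ultimately show ?thesis using y that by auto
qed

definition dist_sphere :: "nat \<Rightarrow> nat \<Rightarrow> nat set" where
  "dist_sphere x i = {y \<in> {1..n}. graph_dist E x y = i}"

lemma finite_dist_sphere [simp]: "finite (dist_sphere x i)"
  by (simp add: dist_sphere_def)

text \<open>Every vertex of a sphere of positive radius has a neighbour one step closer to
  \<open>x\<close>, so at most \<open>r - 1\<close> of its neighbours lie in the next
  sphere.\<close>

lemma card_dist_sphere_le:
  assumes x: "x \<in> {1..n}"
  shows "card (dist_sphere x (Suc i)) \<le> r * (r - 1) ^ i"
proof (induction i)
  case 0
  have "dist_sphere x (Suc 0) \<subseteq> E `` {x}"
  proof
    fix y assume "y \<in> dist_sphere x (Suc 0)"
    then have "(x, y) \<in> E ^^ Suc 0" using geodesic[OF x, of y] by (simp add: dist_sphere_def)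
    then show "y \<in> E `` {x}" by simp
  qed
  then have "card (dist_sphere x (Suc 0)) \<le> card (E `` {x})" by (rule card_mono[OF finite_nbhd])
  also have "\<dots> \<le> r" by (rule card_nbhd_le)
  finally show ?case by simp
next
  case (Suc i)
  have "dist_sphere x (Suc (Suc i)) \<subseteq> (\<Union>y\<in>dist_sphere x (Suc i). E `` {y} - dist_sphere x i)"
  proof
    fix z assume z: "z \<in> dist_sphere x (Suc (Suc i))"
    then obtain y where "y \<in> {1..n}" "(y, z) \<in> E" "graph_dist E x y = Suc i"
      using graph_dist_predecessor[OF x, of z "Suc i"] by (auto simp: dist_sphere_def)
    then show "z \<in> (\<Union>y\<in>dist_sphere x (Suc i). E `` {y} - dist_sphere x i)"
      using z by (auto simp: dist_sphere_def)
  qed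
  then have "card (dist_sphere x (Suc (Suc i))) \<le> card (\<Union>y\<in>dist_sphere x (Suc i). E `` {y} - dist_sphere x i)"
    using finite_nbhd by (intro card_mono) auto
  also have "\<dots> \<le> (\<Sum>y\<in>dist_sphere x (Suc i). card (E `` {y} - dist_sphere x i))"
    by (intro card_UN_le) simp
  also have "\<dots> \<le> (\<Sum>y\<in>dist_sphere x (Suc i). r - 1)"
  proof (rule sum_mono)
    fix y assume y: "y \<in> dist_sphere x (Suc i)"
    then obtain w where w: "w \<in> {1..n}" "(w, y) \<in> E" "graph_dist E x w = i"
      using graph_dist_predecessor[OF x, of y i] by (auto simp: dist_sphere_def)
    have "E `` {y} - dist_sphere x i \<subseteq> E `` {y} - {w}" using w by (auto simp: dist_sphere_def)
    then have "card (E `` {y} - dist_sphere x i) \<le> card (E `` {y} - {w})"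
      using finite_nbhd by (intro card_mono) auto
    also have "\<dots> = card (E `` {y}) - 1" using edge_sym[OF w(2)] finite_nbhd by simp
    also have "\<dots> \<le> r - 1" using card_nbhd_le by (rule diff_le_mono)
    finally show "card (E `` {y} - dist_sphere x i) \<le> r - 1" .
  qed
  also have "\<dots> \<le> r * (r - 1) ^ Suc i" using mult_right_mono[OF Suc.IH, of "r - 1"] by (simp add: mult_ac)
  finally show ?case .
qed

lemma finite_distances: "finite {graph_dist E x y |x y. x \<in> {1..n} \<and> y \<in> {1..n}}"
proof -
  have "{graph_dist E x y |x y. x \<in> {1..n} \<and> y \<in> {1..n}} = (\<Union>x\<in>{1..n}. graph_dist E x ` {1..n})"
    by blast
  then show ?thesis by simp
qed

lemma graph_dist_le_diam:
  assumes "x \<in> {1..n}" "y \<in> {1..n}"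
  shows "graph_dist E x y \<le> graph_diam n E"
  unfolding graph_diam_def by (rule Max_ge[OF finite_distances]) (use assms in blast)

lemma graph_diam_le:
  assumes "n > 0" "\<And>x y. x \<in> {1..n} \<Longrightarrow> y \<in> {1..n} \<Longrightarrow> graph_dist E x y \<le> m"
  shows "graph_diam n E \<le> m"
proof -
  have "1 \<in> {1..n}" using assms(1) by simp
  then show ?thesis unfolding graph_diam_def
    by (intro Max.boundedI[OF finite_distances]) (use assms(2) in blast)+
qed

lemma sum_dist_le:
  fixes K :: "nat \<Rightarrow> real"
  assumes x: "x \<in> {1..n}" and K: "\<And>i. 0 \<le> K i"
  shows "(\<Sum>y\<in>{1..n} - {x}. K (graph_dist E x y))
           \<le> (\<Sum>i<graph_diam n E. real (r * (r - 1) ^ i) * K (Suc i))"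
proof -
  have "{1..n} - {x} \<subseteq> (\<Union>i<graph_diam n E. dist_sphere x (Suc i))"
  proof
    fix y assume y: "y \<in> {1..n} - {x}"
    then have "graph_dist E x y \<noteq> 0" "graph_dist E x y \<le> graph_diam n E"
      using x graph_dist_eq_0_iff graph_dist_le_diam by auto
    then obtain i where "graph_dist E x y = Suc i" "i < graph_diam n E"
      by (cases "graph_dist E x y") auto
    then show "y \<in> (\<Union>i<graph_diam n E. dist_sphere x (Suc i))"
      using y by (auto simp: dist_sphere_def)
  qed
  then have "(\<Sum>y\<in>{1..n} - {x}. K (graph_dist E x y))
      \<le> (\<Sum>y\<in>(\<Union>i<graph_diam n E. dist_sphere x (Suc i)). K (graph_dist E x y))"
    using K by (intro sum_mono2) auto
  also have "\<dots> = (\<Sum>i<graph_diam n E. \<Sum>y\<in>dist_sphere x (Suc i). K (graph_dist E x y))"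
    by (rule sum.UNION_disjoint) (auto simp: dist_sphere_def)
  also have "\<dots> = (\<Sum>i<graph_diam n E. real (card (dist_sphere x (Suc i))) * K (Suc i))"
    by (intro sum.cong refl) (simp add: dist_sphere_def)
  also have "\<dots> \<le> (\<Sum>i<graph_diam n E. real (r * (r - 1) ^ i) * K (Suc i))"
    using card_dist_sphere_le[OF x] K by (intro sum_mono mult_right_mono) (auto simp del: of_nat_mult)
  finally show ?thesis .
qed

text \<open>The vertices are counted by spheres, that is, \<open>sum_dist_le\<close> with constant
  weight 1. For fixed \<open>r\<close> this forces the diameter to grow with
  \<open>n\<close>.\<close>

lemma card_le_diam:
  assumes "n > 0" "r > 0"
  shows "n \<le> Suc (graph_diam n E * r ^ graph_diam n E)"
proof -
  let ?D = "graph_diam n E"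
  have one: "1 \<in> {1..n}" using assms by simp
  have "real (card ({1..n} - {1})) = (\<Sum>y\<in>{1..n} - {1}. 1)" by simp
  also have "\<dots> \<le> (\<Sum>i<?D. real (r * (r - 1) ^ i) * 1)"
    by (rule sum_dist_le[OF one, of "\<lambda>_. 1"]) simp
  also have "\<dots> \<le> (\<Sum>i<?D. real (r ^ ?D))"
  proof (rule sum_mono)
    fix i assume i: "i \<in> {..<?D}"
    have "r * (r - 1) ^ i \<le> r * r ^ i" by (intro mult_left_mono power_mono) auto
    also have "\<dots> = r ^ Suc i" by simp
    also have "\<dots> \<le> r ^ ?D" using i assms by (intro power_increasing) auto
    finally show "real (r * (r - 1) ^ i) * 1 \<le> real (r ^ ?D)" by (simp only: mult_1_right of_nat_le_iff)
  qed
  also have "\<dots> = real (?D * r ^ ?D)" by simp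
  finally have "card ({1..n} - {1}) \<le> ?D * r ^ ?D" by (simp only: of_nat_le_iff)
  then show ?thesis using assms by simp
qed

text \<open>The boundary edges of a ball end in the next sphere, and each vertex there absorbs at
  most \<open>r\<close> of them. So a ball grows by the factor \<open>1 + c / r\<close> until it
  exceeds half of the vertices, which happens by radius \<open>k\<close>; two balls of that size
  meet.\<close>

lemma graph_diam_le_of_expansion:
  fixes c :: real
  assumes n: "n > 0" and r: "r > 0" and c: "c \<ge> 0"
    and expansion: "\<And>A. A \<subseteq> {1..n} \<Longrightarrow> A \<noteq> {} \<Longrightarrow> 2 * card A \<le> n \<Longrightarrow> c * card A \<le> card (edge_boundary E A)"
    and k: "real n < (1 + c / r) ^ k"
  shows "graph_diam n E \<le> 2 * k"
proof (rule graph_diam_le[OF n])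
  define B where "B x j = {y \<in> {1..n}. graph_dist E x y \<le> j}" for x j
  have B_sub: "B x j \<subseteq> {1..n}" for x j by (auto simp: B_def)
  have fin: "finite (B x j)" for x j by (simp add: B_def)
  have mono: "B x j \<subseteq> B x (Suc j)" for x j by (auto simp: B_def)
  have grow: "(1 + c / r) ^ j \<le> card (B x j) \<or> n < 2 * card (B x j)" if x: "x \<in> {1..n}" for x j
  proof (induction j)
    case 0
    have "B x 0 = {x}" using x graph_dist_eq_0_iff by (auto simp: B_def)
    then show ?case by simp
  next
    case (Suc j)
    show ?case
    proof (cases "n < 2 * card (B x j)")
      case True
      then show ?thesis using card_mono[OF fin mono, of x j] by linarith
    next
      case False
      have "x \<in> B x j" using x graph_dist_eq_0_iff[OF x x] by (simp add: B_def)
      then have "c * card (B x j) \<le> card (edge_boundary E (B x j))"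
        using False B_sub by (intro expansion) auto
      also have "edge_boundary E (B x j) \<subseteq> {(u, v) \<in> E. v \<in> B x (Suc j) - B x j}"
        using graph_dist_step[OF x] E_sub by (fastforce simp: edge_boundary_def B_def)
      then have "card (edge_boundary E (B x j)) \<le> card {(u, v) \<in> E. v \<in> B x (Suc j) - B x j}"
        using finite_E by (intro card_mono) (auto intro: rev_finite_subset)
      also have "\<dots> \<le> card (B x (Suc j) - B x j) * r"
        using fin by (intro card_edges_to[OF regular]) simp
      also have "card (B x (Suc j) - B x j) = card (B x (Suc j)) - card (B x j)"
        using fin mono by (intro card_Diff_subset) auto
      finally have "c * card (B x j) \<le> (real (card (B x (Suc j))) - real (card (B x j))) * r"
        using card_mono[OF fin mono, of x j] by (simp add: of_nat_diff)
      then have "(1 + c / r) * card (B x j) \<le> card (B x (Suc j))"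
        using r by (simp add: field_simps)
      moreover have "(1 + c / r) * (1 + c / r) ^ j \<le> (1 + c / r) * card (B x j)"
        using Suc.IH False c by (intro mult_left_mono) auto
      ultimately show ?thesis by simp
    qed
  qed
  have big: "n < 2 * card (B x k)" if x: "x \<in> {1..n}" for x
  proof -
    have "card (B x k) \<le> n" using card_mono[OF _ B_sub[of x k]] by simp
    then show ?thesis using grow[OF x, of k] k by linarith
  qed
  fix x y assume xy: "x \<in> {1..n}" "y \<in> {1..n}"
  have "B x k \<inter> B y k \<noteq> {}"
  proof
    assume "B x k \<inter> B y k = {}"
    then have "card (B x k) + card (B y k) = card (B x k \<union> B y k)"
      using fin by (simp add: card_Un_disjoint)
    also have "\<dots> \<le> n" using card_mono[of "{1..n}" "B x k \<union> B y k"] B_sub by simp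
    finally show False using big[OF xy(1)] big[OF xy(2)] by linarith
  qed
  then obtain z where z: "z \<in> {1..n}" "graph_dist E x z \<le> k" "graph_dist E y z \<le> k"
    by (auto simp: B_def)
  have "(x, y) \<in> E ^^ (graph_dist E x z + graph_dist E y z)"
    using geodesic[OF xy(1) z(1)] relpow_sym[OF sym_E geodesic[OF xy(2) z(1)]] by (rule relpow_trans)
  then have "graph_dist E x y \<le> graph_dist E x z + graph_dist E y z" by (rule graph_dist_le)
  then show "graph_dist E x y \<le> 2 * k" using z by linarith
qed

end

section \<open>Cheeger constant and connectedness\<close>

lemma cheeger_le:
  assumes "A \<subseteq> {1..n}" "A \<noteq> {}" "2 * card A \<le> n"
  shows "cheeger n E * card A \<le> card (edge_boundary E A)"
proof -
  have fin: "finite A" using assms(1) finite_subset by auto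
  then have pos: "card A > 0" using assms(2) by (simp add: card_gt_0_iff)
  let ?C = "{real (card (edge_boundary E A)) / real (card A) | A.
            A \<subseteq> {1..n} \<and> 1 \<le> card A \<and> real (card A) \<le> real n / 2}"
  have "?C \<subseteq> (\<lambda>A. real (card (edge_boundary E A)) / real (card A)) ` Pow {1..n}" by auto
  then have "finite ?C" by (rule finite_subset) simp
  then have "cheeger n E \<le> card (edge_boundary E A) / card A"
    unfolding cheeger_def
    using assms pos by (intro Min_le) (auto intro!: exI[of _ A])
  then show ?thesis using pos by (simp add: field_simps)
qed

text \<open>If \<open>y\<close> lay outside the component of \<open>x\<close>, the component and its
  complement would be nonempty with empty edge boundary. One of them has at most
  \<open>n / 2\<close> vertices and contradicts the positive Cheeger constant.\<close>

lemma connected_regular_graphI: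
  assumes E: "E \<in> regular_graphs r n" and c: "cheeger n E > 0"
  shows "connected_regular_graph r n E"
proof
  show "E \<in> regular_graphs r n" by fact
  fix x y assume xy: "x \<in> {1..n}" "y \<in> {1..n}"
  note D = regular_graphsD[OF E]
  define C where "C = {z \<in> {1..n}. \<exists>k. (x, z) \<in> E ^^ k}"
  have closed: "a \<in> C \<longleftrightarrow> b \<in> C" if "(a, b) \<in> E" for a b
    using that D(1) symD[OF D(3) that] unfolding C_def
    by (auto intro: relpow_Suc_I simp del: relpow.simps)
  have boundary: "edge_boundary E C = {}" "edge_boundary E ({1..n} - C) = {}"
    using closed D(1) by (auto simp: edge_boundary_def)
  have xC: "x \<in> C" using xy by (auto simp: C_def intro: exI[of _ 0])
  have CV: "C \<subseteq> {1..n}" by (auto simp: C_def)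
  show "\<exists>k. (x, y) \<in> E ^^ k"
  proof (rule ccontr)
    assume "\<nexists>k. (x, y) \<in> E ^^ k"
    then have yC: "y \<in> {1..n} - C" using xy by (simp add: C_def)
    have small: False if A: "A \<subseteq> {1..n}" "A \<noteq> {}" "2 * card A \<le> n" "edge_boundary E A = {}" for A
    proof -
      have "card A > 0" using A finite_subset by (auto simp: card_gt_0_iff)
      then show False using cheeger_le[OF A(1-3), of E] A(4) c by (simp add: mult_le_0_iff)
    qed
    have "card ({1..n} - C) = n - card C"
      using CV by (subst card_Diff_subset) (auto intro: finite_subset)
    then consider "2 * card C \<le> n" | "2 * card ({1..n} - C) \<le> n" by linarith
    then show False
    proof cases
      case 1
      show False by (rule small[OF CV _ 1 boundary(1)]) (use xC in auto)
    next
      case 2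
      show False by (rule small[OF _ _ 2 boundary(2)]) (use yC in auto)
    qed
  qed
qed

section \<open>Energy landscape\<close>

definition spin :: "nat \<Rightarrow> nat set \<Rightarrow> nat \<Rightarrow> real" where
  "spin n A = (\<lambda>x\<in>{1..n}. if x \<in> A then 1 else -1)"

definition plus_set :: "nat \<Rightarrow> (nat \<Rightarrow> real) \<Rightarrow> nat set" where
  "plus_set n \<sigma> = {x \<in> {1..n}. \<sigma> x = 1}"

definition cut_weight :: "nat \<Rightarrow> (nat \<times> nat) set \<Rightarrow> (nat \<Rightarrow> real) \<Rightarrow> nat set \<Rightarrow> real" where
  "cut_weight n E K A = (\<Sum>(x, y)\<in>A \<times> ({1..n} - A). K (graph_dist E x y))"

lemma spin_in_configs [simp]: "spin n A \<in> configs n"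
  by (auto simp: spin_def configs_def)

lemma spin_plus_set: "\<sigma> \<in> configs n \<Longrightarrow> spin n (plus_set n \<sigma>) = \<sigma>"
  by (force simp: spin_def plus_set_def configs_def PiE_def extensional_def)

lemma plus_set_sub: "plus_set n \<sigma> \<subseteq> {1..n}"
  by (auto simp: plus_set_def)

lemma spin_empty: "spin n {} = all_minus n"
  by (simp add: spin_def all_minus_def)

lemma finite_configs: "finite (configs n)"
  unfolding configs_def by (intro finite_PiE) auto

text \<open>Compared with all spins minus, exactly the pairs cut by \<open>A\<close> change sign.
  The work lies in the orientation: the Hamiltonian lists pairs increasingly, the cut lists them
  from \<open>A\<close> to its complement.\<close>

lemma hamiltonian_spin:
  assumes "sym E" and A: "A \<subseteq> {1..n}"
  shows "hamiltonian n E K h (spin n A) - hamiltonian n E K h (all_minus n)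
           = 2 * cut_weight n E K A - 2 * h * card A"
proof -
  let ?V = "{1..n}"
  define L where "L = {(x, y). x \<in> ?V \<and> y \<in> ?V \<and> x < y}"
  define k where "k = (\<lambda>(x, y). K (graph_dist E x y))"
  have k_swap: "k (prod.swap p) = k p" for p
    using assms(1) graph_dist_sym by (auto simp: k_def split: prod.split)
  have finL: "finite L" by (rule finite_subset[of _ "?V \<times> ?V"]) (auto simp: L_def)
  have finA: "finite A" using A finite_subset by auto
  define P where "P = A \<times> (?V - A)"
  have finP: "finite P" using finA by (simp add: P_def)
  have term1: "K (graph_dist E x y) * spin n A x * spin n A y = k (x, y) -
      (if (x, y) \<in> P then 2 * k (x, y) else 0) - (if (y, x) \<in> P then 2 * k (x, y) else 0)"
    if "(x, y) \<in> L" for x y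
    using that by (auto simp: k_def spin_def L_def P_def)
  have "(\<Sum>(x, y)\<in>L. K (graph_dist E x y) * spin n A x * spin n A y) =
      (\<Sum>p\<in>L. k p - (if p \<in> P then 2 * k p else 0) - (if prod.swap p \<in> P then 2 * k p else 0))"
    using term1 by (intro sum.cong refl) auto
  also have "\<dots> = (\<Sum>p\<in>L. k p) - ((\<Sum>p\<in>L. if p \<in> P then 2 * k p else 0)
      + (\<Sum>p\<in>L. if prod.swap p \<in> P then 2 * k p else 0))"
    by (simp add: sum_subtractf)
  also have "(\<Sum>p\<in>L. if p \<in> P then 2 * k p else 0) = (\<Sum>p\<in>P \<inter> L. 2 * k p)"
    using finL by (simp add: Int_commute flip: sum.inter_restrict)
  \<comment> \<open>Swapping the entries identifies the cut pairs whose plus end is the larger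
    vertex with \<open>P - L\<close>; together with \<open>P \<inter> L\<close> they give every cut
    pair once.\<close>
  also have "(\<Sum>p\<in>L. if prod.swap p \<in> P then 2 * k p else 0) = (\<Sum>p\<in>P - L. 2 * k p)"
  proof -
    have swap_L: "prod.swap p \<in> L \<longleftrightarrow> p \<notin> L" if "p \<in> P" for p
    proof -
      obtain x y where p: "p = (x, y)" by (cases p)
      have "x \<in> ?V" "y \<in> ?V" "x \<noteq> y" using that A by (auto simp: P_def p)
      then show ?thesis by (auto simp: L_def p)
    qed
    have "(\<Sum>p\<in>L. if prod.swap p \<in> P then 2 * k p else 0) = (\<Sum>p\<in>{p \<in> L. prod.swap p \<in> P}. 2 * k p)"
      using finL by (simp flip: sum.inter_filter)
    also have "\<dots> = (\<Sum>p\<in>P - L. 2 * k p)"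
    proof (rule sum.reindex_bij_witness[of _ prod.swap prod.swap])
      fix p assume "p \<in> {p \<in> L. prod.swap p \<in> P}"
      then show "prod.swap p \<in> P - L" "2 * k (prod.swap p) = 2 * k p"
        using swap_L[of "prod.swap p"] by (simp_all add: k_swap)
    next
      fix p assume "p \<in> P - L"
      then show "prod.swap p \<in> {p \<in> L. prod.swap p \<in> P}" using swap_L[of p] by simp
    qed simp_all
    finally show ?thesis .
  qed
  also have "(\<Sum>p\<in>P \<inter> L. 2 * k p) + (\<Sum>p\<in>P - L. 2 * k p) = (\<Sum>p\<in>P. 2 * k p)"
    using finP by (subst sum.Int_Diff[of P _ L]) auto
  also have "\<dots> = 2 * cut_weight n E K A" by (simp add: cut_weight_def k_def P_def sum_distrib_left)
  finally have pairs: "(\<Sum>(x, y)\<in>L. K (graph_dist E x y) * spin n A x * spin n A y) =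
      (\<Sum>p\<in>L. k p) - 2 * cut_weight n E K A" .
  have pairs0: "(\<Sum>(x, y)\<in>L. K (graph_dist E x y) * all_minus n x * all_minus n y) = (\<Sum>p\<in>L. k p)"
    by (intro sum.cong refl) (auto simp: all_minus_def L_def k_def)
  have "(\<Sum>x\<in>?V. spin n A x) = (\<Sum>x\<in>?V. (if x \<in> A then 2 else 0) - 1)"
    by (intro sum.cong refl) (auto simp: spin_def)
  also have "\<dots> = (\<Sum>x\<in>?V. if x \<in> A then 2 else 0) - real n" by (simp add: sum_subtractf)
  also have "(\<Sum>x\<in>?V. if x \<in> A then 2 else 0) = (\<Sum>x\<in>?V \<inter> A. (2::real))"
    by (rule sum.inter_restrict[symmetric]) simp
  also have "?V \<inter> A = A" using A by auto
  finally have field: "(\<Sum>x\<in>?V. spin n A x) = 2 * real (card A) - n" by simp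
  have "(\<Sum>x\<in>?V. all_minus n x) = (\<Sum>x\<in>?V. -1)" by (intro sum.cong) (auto simp: all_minus_def)
  then have field0: "(\<Sum>x\<in>?V. all_minus n x) = - real n" by simp
  show ?thesis
    unfolding hamiltonian_def L_def[symmetric] pairs pairs0 field field0
    by (simp add: algebra_simps)
qed

section \<open>Paths, communication heights and the stability level\<close>

lemma spin_path_exists:
  assumes "A \<subseteq> {1..n}"
  shows "\<exists>\<omega>. spin_path n (all_minus n) (spin n A) \<omega>"
proof -
  have "finite A" using assms finite_subset by auto
  then show ?thesis using assms
  proof (induction A)
    case empty
    have "spin_path n (all_minus n) (spin n {}) [spin n {}]"
      unfolding spin_path_def by (auto simp: spin_empty[symmetric])
    then show ?case by blast
  next
    case (insert x A)
    then obtain \<omega> where \<omega>: "spin_path n (all_minus n) (spin n A) \<omega>" by auto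
    have flip: "spin n (insert x A) = (spin n A)(x := - spin n A x)"
      using insert.hyps(2) insert.prems by (auto simp: spin_def)
    have x: "x \<in> {1..n}" using insert.prems by simp
    let ?R = "\<lambda>\<xi> \<xi>' :: nat \<Rightarrow> real. \<exists>x\<in>{1..n}. \<xi>' = \<xi>(x := - \<xi> x)"
    have last: "last \<omega> = spin n A" using \<omega> by (simp add: spin_path_def)
    have "?R (last \<omega>) (spin n (insert x A))"
      unfolding flip last by (rule bexI[where x = x], rule refl, rule x)
    then have "successively ?R (\<omega> @ [spin n (insert x A)])"
      using \<omega> unfolding spin_path_def by (simp only: successively_append_iff) simp
    then have "spin_path n (all_minus n) (spin n (insert x A)) (\<omega> @ [spin n (insert x A)])"
      using \<omega> unfolding spin_path_def by simp
    then show ?case by blast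
  qed
qed

text \<open>A discrete intermediate value theorem: only upward steps are bounded, drops may have any
  size.\<close>

lemma list_hits_level:
  fixes f :: "'a \<Rightarrow> nat"
  assumes "successively (\<lambda>a b. f b \<le> Suc (f a)) xs" "xs \<noteq> []" "f (hd xs) \<le> m" "m \<le> f (last xs)"
  shows "\<exists>x\<in>set xs. f x = m"
  using assms
proof (induction xs)
  case (Cons a xs)
  show ?case
  proof (cases "xs = [] \<or> f a = m")
    case False
    then have "f (hd xs) \<le> m" using Cons.prems by (auto simp: successively_Cons)
    then show ?thesis using Cons False by (auto simp: successively_Cons)
  qed (use Cons.prems in auto)
qed simp

lemma spin_path_hits_level:
  assumes "spin_path n (all_minus n) \<eta> \<omega>" "m \<le> card (plus_set n \<eta>)"
  shows "\<exists>\<xi>\<in>set \<omega>. card (plus_set n \<xi>) = m"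
proof (rule list_hits_level)
  have "card (plus_set n (\<xi>(x := - \<xi> x))) \<le> Suc (card (plus_set n \<xi>))" for \<xi> x
  proof -
    have "plus_set n (\<xi>(x := - \<xi> x)) \<subseteq> insert x (plus_set n \<xi>)" by (auto simp: plus_set_def)
    then have "card (plus_set n (\<xi>(x := - \<xi> x))) \<le> card (insert x (plus_set n \<xi>))"
      by (intro card_mono) (auto simp: plus_set_def)
    also have "\<dots> \<le> Suc (card (plus_set n \<xi>))" by (rule card_insert_le_m1[rotated]) auto
    finally show ?thesis .
  qed
  then show "successively (\<lambda>\<xi> \<xi>'. card (plus_set n \<xi>') \<le> Suc (card (plus_set n \<xi>))) \<omega>"
    using assms(1) unfolding spin_path_def by (auto elim!: successively_mono)
  have "plus_set n (all_minus n) = {}" by (auto simp: plus_set_def all_minus_def)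
  then show "\<omega> \<noteq> []" "card (plus_set n (hd \<omega>)) \<le> m" "m \<le> card (plus_set n (last \<omega>))"
    using assms unfolding spin_path_def by auto
qed

text \<open>The height of a path depends only on the set of configurations visited, and there are
  finitely many such sets.\<close>

lemma finite_path_heights: "finite {Max (H ` set \<omega>) |\<omega>. spin_path n \<sigma> \<eta> \<omega>}"
proof (rule finite_subset)
  show "{Max (H ` set \<omega>) |\<omega>. spin_path n \<sigma> \<eta> \<omega>} \<subseteq> (\<lambda>X. Max (H ` X)) ` Pow (configs n)"
    by (auto simp: spin_path_def)
qed (simp add: finite_configs)

lemma communication_height_ge:
  assumes "\<exists>\<omega>. spin_path n \<sigma> \<eta> \<omega>"
    and "\<And>\<omega>. spin_path n \<sigma> \<eta> \<omega> \<Longrightarrow> \<exists>\<xi>\<in>set \<omega>. b \<le> H \<xi>"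
  shows "b \<le> communication_height n H \<sigma> \<eta>"
proof -
  have "b \<le> Max (H ` set \<omega>)" if \<omega>: "spin_path n \<sigma> \<eta> \<omega>" for \<omega>
  proof -
    obtain \<xi> where \<xi>: "\<xi> \<in> set \<omega>" "b \<le> H \<xi>" using assms(2)[OF \<omega>] by auto
    have "H \<xi> \<le> Max (H ` set \<omega>)" using \<xi>(1) by (intro Max_ge) auto
    then show ?thesis using \<xi>(2) by linarith
  qed
  then show ?thesis unfolding communication_height_def using assms(1)
    by (subst Min_ge_iff) (auto simp: finite_path_heights)
qed

lemma communication_height_le:
  assumes "\<exists>\<omega>. spin_path n \<sigma> \<eta> \<omega>" and "\<And>\<xi>. \<xi> \<in> configs n \<Longrightarrow> H \<xi> \<le> b"
  shows "communication_height n H \<sigma> \<eta> \<le> b"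
proof -
  obtain \<omega> where \<omega>: "spin_path n \<sigma> \<eta> \<omega>" using assms(1) by auto
  then have "communication_height n H \<sigma> \<eta> \<le> Max (H ` set \<omega>)"
    unfolding communication_height_def by (intro Min_le finite_path_heights) auto
  also have "\<dots> \<le> b"
    using \<omega> assms(2) by (subst Max_le_iff) (auto simp: spin_path_def)
  finally show ?thesis .
qed

text \<open>No path is optimised: every configuration lies at most \<open>S * n\<close> above the
  start. By symmetry of the cut, its weight is at most \<open>S\<close> times the smaller side,
  hence at most \<open>S * n / 2\<close>, and plus spins only gain from the field. The all-plus
  configuration serves as the target of lower energy.\<close>

lemma stability_level_le:
  fixes h S :: real
  assumes E: "sym E" and n: "n > 0" and h: "h > 0" and K: "\<And>i. 0 \<le> K i"
    and S: "\<And>x. x \<in> {1..n} \<Longrightarrow> (\<Sum>y\<in>{1..n} - {x}. K (graph_dist E x y)) \<le> S"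
  shows "stability_level n (hamiltonian n E K h) (all_minus n) \<le> ereal (S * n)"
proof -
  let ?H = "hamiltonian n E K h" and ?m = "all_minus n"
  have "0 \<le> (\<Sum>y\<in>{1..n} - {1}. K (graph_dist E 1 y))" by (intro sum_nonneg K)
  then have S0: "S \<ge> 0" using S[of 1] n by simp
  have cut1: "cut_weight n E K A \<le> S * card A" if A: "A \<subseteq> {1..n}" for A
  proof -
    have "cut_weight n E K A = (\<Sum>x\<in>A. \<Sum>y\<in>{1..n} - A. K (graph_dist E x y))"
      unfolding cut_weight_def by (simp add: sum.cartesian_product)
    also have "\<dots> \<le> (\<Sum>x\<in>A. S)"
    proof (rule sum_mono)
      fix x assume x: "x \<in> A"
      have "(\<Sum>y\<in>{1..n} - A. K (graph_dist E x y)) \<le> (\<Sum>y\<in>{1..n} - {x}. K (graph_dist E x y))"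
        using x K by (intro sum_mono2) auto
      also have "\<dots> \<le> S" using x A by (intro S) auto
      finally show "(\<Sum>y\<in>{1..n} - A. K (graph_dist E x y)) \<le> S" .
    qed
    finally show ?thesis by (simp add: mult.commute)
  qed
  have cut_compl: "cut_weight n E K ({1..n} - A) = cut_weight n E K A" if A: "A \<subseteq> {1..n}" for A
  proof -
    have "cut_weight n E K ({1..n} - A) = (\<Sum>(x, y)\<in>({1..n} - A) \<times> A. K (graph_dist E x y))"
      using A by (simp add: cut_weight_def double_diff)
    also have "\<dots> = (\<Sum>(x, y)\<in>A \<times> ({1..n} - A). K (graph_dist E y x))"
      by (rule sum.reindex_bij_witness[of _ prod.swap prod.swap]) auto
    finally show ?thesis by (simp add: cut_weight_def graph_dist_sym[OF E])
  qed
  have bound: "?H \<xi> \<le> ?H ?m + S * n" if "\<xi> \<in> configs n" for \<xi>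
  proof -
    define A where "A = plus_set n \<xi>"
    have A: "A \<subseteq> {1..n}" "\<xi> = spin n A" using that plus_set_sub by (auto simp: A_def spin_plus_set)
    have "card ({1..n} - A) = n - card A"
      using A(1) by (subst card_Diff_subset) (auto intro: finite_subset)
    then have "real (card A) \<le> n / 2 \<or> real (card ({1..n} - A)) \<le> n / 2" by auto
    then have "cut_weight n E K A \<le> S * (n / 2)"
    proof
      assume "real (card A) \<le> n / 2"
      then have "S * card A \<le> S * (n / 2)" using S0 by (rule mult_left_mono)
      then show ?thesis using cut1[OF A(1)] by linarith
    next
      assume "real (card ({1..n} - A)) \<le> n / 2"
      then have "S * card ({1..n} - A) \<le> S * (n / 2)" using S0 by (rule mult_left_mono)
      then show ?thesis using cut1[of "{1..n} - A"] cut_compl[OF A(1)] by auto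
    qed
    moreover have "0 \<le> 2 * h * card A" using h by simp
    ultimately show ?thesis using hamiltonian_spin[OF E A(1), of K h] A(2) by simp
  qed
  have "?H (spin n {1..n}) < ?H ?m"
  proof -
    have "?H (spin n {1..n}) - ?H ?m = - (2 * (h * n))"
      using hamiltonian_spin[OF E subset_refl, of n K h] by (simp add: cut_weight_def)
    moreover have "0 < h * n" using n h by simp
    ultimately show ?thesis by linarith
  qed
  then have "(INF \<eta>\<in>{\<eta> \<in> configs n. ?H \<eta> < ?H ?m}. ereal (communication_height n ?H ?m \<eta>))
      \<le> ereal (communication_height n ?H ?m (spin n {1..n}))"
    by (intro INF_lower) simp
  also have "\<dots> \<le> ereal (?H ?m + S * n)"
    unfolding ereal_less_eq using bound by (intro communication_height_le spin_path_exists) auto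
  finally show ?thesis unfolding stability_level_def
    by (simp add: ereal_minus_le add.commute)
qed

text \<open>By \<open>barrier\<close>, a configuration below the start has more than
  \<open>n div 2\<close> plus spins. A path to it therefore passes through exactly
  \<open>n div 2\<close> of them, where \<open>top\<close> gives the height.\<close>

lemma stability_level_ge:
  fixes h L :: real
  assumes E: "sym E"
    and barrier: "\<And>A. A \<subseteq> {1..n} \<Longrightarrow> card A \<le> n div 2 \<Longrightarrow> h * card A \<le> cut_weight n E K A"
    and top: "\<And>A. A \<subseteq> {1..n} \<Longrightarrow> card A = n div 2 \<Longrightarrow> L \<le> 2 * cut_weight n E K A - 2 * h * card A"
  shows "ereal L \<le> stability_level n (hamiltonian n E K h) (all_minus n)"
proof -
  let ?H = "hamiltonian n E K h" and ?m = "all_minus n"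
  have "ereal (?H ?m + L) \<le> (INF \<eta>\<in>{\<eta> \<in> configs n. ?H \<eta> < ?H ?m}. ereal (communication_height n ?H ?m \<eta>))"
  proof (rule INF_greatest)
    fix \<eta> assume "\<eta> \<in> {\<eta> \<in> configs n. ?H \<eta> < ?H ?m}"
    then have \<eta>: "\<eta> \<in> configs n" "?H \<eta> < ?H ?m" by auto
    define B where "B = plus_set n \<eta>"
    have B: "B \<subseteq> {1..n}" "spin n B = \<eta>" using \<eta> plus_set_sub by (auto simp: B_def spin_plus_set)
    have "\<not> card B \<le> n div 2"
      using barrier[OF B(1)] hamiltonian_spin[OF E B(1), of K h] B(2) \<eta>(2) by auto
    then have "n div 2 \<le> card (plus_set n \<eta>)" by (simp add: B_def)
    moreover have "?H ?m + L \<le> ?H \<xi>" if "\<xi> \<in> configs n" "card (plus_set n \<xi>) = n div 2" for \<xi>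
      using hamiltonian_spin[OF E plus_set_sub[of n \<xi>], of K h] top[OF plus_set_sub that(2)] that(1)
      by (simp add: spin_plus_set)
    ultimately have hits: "\<exists>\<xi>\<in>set \<omega>. ?H ?m + L \<le> ?H \<xi>" if "spin_path n ?m \<eta> \<omega>" for \<omega>
      using spin_path_hits_level[OF that] that unfolding spin_path_def by blast
    have "?H ?m + L \<le> communication_height n ?H ?m \<eta>"
      using spin_path_exists[OF B(1)] hits unfolding B(2) by (rule communication_height_ge)
    then show "ereal (?H ?m + L) \<le> ereal (communication_height n ?H ?m \<eta>)" by simp
  qed
  then show ?thesis unfolding stability_level_def
    by (simp add: ereal_le_minus add.commute)
qed

section \<open>Bounds on the stability level\<close>

lemma coupling_nonneg: "J > 0 \<Longrightarrow> 0 \<le> coupling c J r i"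
  by (cases c) auto

lemma coupling_1: "r > 0 \<Longrightarrow> coupling c J r 1 = J"
  by (cases c) auto

text \<open>The sphere of radius \<open>Suc i\<close> contributes at most
  \<open>J * r * q ^ i\<close> with \<open>q = (r - 1) / r\<close>, and the geometric series is
  bounded by \<open>1 / (1 - q) = r\<close>.\<close>

lemma sum_exponential_coupling_le:
  assumes r: "r \<ge> 2" and J: "J > 0"
  shows "(\<Sum>i<D. real (r * (r - 1) ^ i) * coupling Exponential J r (Suc i)) \<le> J * (real r * real r)"
proof -
  define q where "q = (real r - 1) / real r"
  have q: "0 \<le> q" "q < 1" using r by (auto simp: q_def field_simps)
  have term1: "real (r * (r - 1) ^ i) * coupling Exponential J r (Suc i) = J * real r * q ^ i" for i
  proof -
    have p: "real r powr (1 - real (Suc i)) = 1 / real r ^ i"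
      using r by (simp add: powr_minus powr_realpow divide_inverse)
    have e: "real (r * (r - 1) ^ i) = real r * (real r - 1) ^ i" using r by (simp add: of_nat_diff)
    show ?thesis unfolding e coupling.simps p by (simp add: q_def power_divide)
  qed
  have "(\<Sum>i<D. q ^ i) = (1 - q ^ D) / (1 - q)" using q by (simp add: sum_gp_strict)
  also have "\<dots> \<le> 1 / (1 - q)" using q by (intro divide_right_mono) auto
  also have "\<dots> = real r" using r by (simp add: q_def field_simps)
  finally have "J * real r * (\<Sum>i<D. q ^ i) \<le> J * real r * real r"
    using J by (intro mult_left_mono) auto
  then show ?thesis unfolding term1 by (simp add: sum_distrib_left mult.assoc)
qed

text \<open>Every sphere size is bounded by the crude \<open>r * (r - 1) ^ D\<close>; what remains
  is a partial sum of the zeta series.\<close>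

lemma sum_power_law_coupling_le:
  assumes r: "r \<ge> 2" and J: "J > 0" and l: "l > 1"
  shows "(\<Sum>i<D. real (r * (r - 1) ^ i) * coupling (Power_Law l) J r (Suc i))
           \<le> J * (real r * (zeta_real l * (real r - 1) ^ D))"
proof -
  have "summable (\<lambda>k. real (Suc k) powr (- l))"
    using l by (subst summable_Suc_iff) (simp add: summable_real_powr_iff)
  then have z: "(\<Sum>i<D. real (Suc i) powr (- l)) \<le> zeta_real l"
    unfolding zeta_real_def by (rule sum_le_suminf) auto
  have "(\<Sum>i<D. real (r * (r - 1) ^ i) * coupling (Power_Law l) J r (Suc i)) \<le>
      (\<Sum>i<D. J * real r * (real r - 1) ^ D * real (Suc i) powr (- l))"
  proof (rule sum_mono)
    fix i assume i: "i \<in> {..<D}"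
    have "real (r * (r - 1) ^ i) = real r * (real r - 1) ^ i" using r by (simp add: of_nat_diff)
    also have "\<dots> \<le> real r * (real r - 1) ^ D"
      using r i by (intro mult_left_mono power_increasing) auto
    finally have "real (r * (r - 1) ^ i) * (J * real (Suc i) powr (- l))
        \<le> real r * (real r - 1) ^ D * (J * real (Suc i) powr (- l))"
      using J by (intro mult_right_mono) auto
    then show "real (r * (r - 1) ^ i) * coupling (Power_Law l) J r (Suc i)
        \<le> J * real r * (real r - 1) ^ D * real (Suc i) powr (- l)"
      by (simp add: mult_ac)
  qed
  also have "\<dots> = J * real r * (real r - 1) ^ D * (\<Sum>i<D. real (Suc i) powr (- l))"
    by (simp add: sum_distrib_left)
  also have "\<dots> \<le> J * real r * (real r - 1) ^ D * zeta_real l"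
    using z r J by (intro mult_left_mono) auto
  finally show ?thesis by (simp add: mult_ac)
qed

context connected_regular_graph
begin

lemma stability_level_le_upper_factor:
  fixes J h :: real
  assumes r: "r \<ge> 3" and n: "n > 0" and J: "J > 0" and h: "h > 0"
    and c: "c = Exponential \<or> (\<exists>l>2. c = Power_Law l \<and> l < real (graph_diam n E))"
  shows "stability_level n (hamiltonian n E (coupling c J r) h) (all_minus n)
    \<le> ereal (J * (real r * upper_factor c r (graph_diam n E)) * n)"
proof (rule stability_level_le[OF sym_E n h coupling_nonneg[OF J]])
  fix x assume x: "x \<in> {1..n}"
  have "(\<Sum>y\<in>{1..n} - {x}. coupling c J r (graph_dist E x y))
      \<le> (\<Sum>i<graph_diam n E. real (r * (r - 1) ^ i) * coupling c J r (Suc i))"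
    by (rule sum_dist_le[OF x coupling_nonneg[OF J]])
  also have "\<dots> \<le> J * (real r * upper_factor c r (graph_diam n E))"
    using c
  proof
    assume "c = Exponential"
    then show ?thesis using sum_exponential_coupling_le[OF _ J, of r "graph_diam n E"] r by simp
  next
    assume "\<exists>l>2. c = Power_Law l \<and> l < real (graph_diam n E)"
    then obtain l where l: "l > 2" "c = Power_Law l" "l < real (graph_diam n E)" by auto
    then show ?thesis
      using sum_power_law_coupling_le[OF _ J, of r l "graph_diam n E"] r by (simp del: coupling.simps)
  qed
  finally show "(\<Sum>y\<in>{1..n} - {x}. coupling c J r (graph_dist E x y))
      \<le> J * (real r * upper_factor c r (graph_diam n E))" .
qed

text \<open>For fixed \<open>r\<close> and \<open>l\<close> this excludes the branch
  \<open>l \<ge> d\<close> of \<open>upper_factor\<close> once \<open>n\<close> is large.\<close>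

lemma graph_diam_gt:
  fixes l :: real
  assumes "r > 0" "real (Suc (nat \<lceil>l\<rceil> * r ^ nat \<lceil>l\<rceil>)) < n"
  shows "l < real (graph_diam n E)"
proof (rule ccontr)
  assume "\<not> l < real (graph_diam n E)"
  then have D: "graph_diam n E \<le> nat \<lceil>l\<rceil>" by linarith
  have n: "Suc (nat \<lceil>l\<rceil> * r ^ nat \<lceil>l\<rceil>) < n" using assms(2) by (simp only: of_nat_less_iff)
  have "n \<le> Suc (graph_diam n E * r ^ graph_diam n E)" using assms(1) n by (intro card_le_diam) auto
  also have "\<dots> \<le> Suc (nat \<lceil>l\<rceil> * r ^ nat \<lceil>l\<rceil>)"
    using D assms(1) by (intro Suc_leI le_imp_less_Suc mult_mono power_increasing) auto
  finally show False using n by simp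
qed

text \<open>Boundary edges are cut pairs at distance 1, and \<open>second_cut\<close> consists of
  cut pairs at distance 2. All other cut pairs contribute nonnegatively.\<close>

lemma edge_boundary_second_cut_le:
  fixes K :: "nat \<Rightarrow> real"
  assumes A: "A \<subseteq> {1..n}" and K: "\<And>i. 0 \<le> K i"
  shows "K 1 * card (edge_boundary E A) + K 2 * card (second_cut n E A) \<le> cut_weight n E K A"
proof -
  have fin: "finite A" using A by (rule finite_subset) simp
  have cut_sub: "second_cut n E A \<subseteq> A \<times> ({1..n} - A)" "edge_boundary E A \<subseteq> A \<times> ({1..n} - A)"
    using E_sub by (auto simp: second_cut_def edge_boundary_def)
  have finB: "finite (edge_boundary E A)"
    using finite_E by (rule rev_finite_subset) (auto simp: edge_boundary_def)
  have finS: "finite (second_cut n E A)"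
    using cut_sub(1) by (rule finite_subset) (simp add: fin)
  have "K 1 * card (edge_boundary E A) = (\<Sum>p\<in>edge_boundary E A. K (graph_dist E (fst p) (snd p)))"
    using graph_dist_edge by (simp add: edge_boundary_def mult.commute case_prod_unfold)
  moreover have "K 2 * card (second_cut n E A) = (\<Sum>p\<in>second_cut n E A. K (graph_dist E (fst p) (snd p)))"
    using graph_dist_second_cut[OF A] by (simp add: mult.commute)
  moreover have "edge_boundary E A \<inter> second_cut n E A = {}"
    by (auto simp: edge_boundary_def second_cut_def)
  ultimately have "K 1 * card (edge_boundary E A) + K 2 * card (second_cut n E A) =
      (\<Sum>p\<in>edge_boundary E A \<union> second_cut n E A. K (graph_dist E (fst p) (snd p)))"
    using finB finS by (simp add: sum.union_disjoint)
  also have "\<dots> \<le> (\<Sum>p\<in>A \<times> ({1..n} - A). K (graph_dist E (fst p) (snd p)))"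
    using cut_sub by (intro sum_mono2) (simp_all add: fin K)
  finally show ?thesis by (simp add: cut_weight_def case_prod_unfold)
qed

text \<open>Both couplings equal \<open>J\<close> at distance 1, so up to size
  \<open>n div 2\<close> the boundary edges alone outweigh the field: \<open>J * card (edge_boundary
  E A) \<ge> J * cheeger n E * card A \<ge> h * card A\<close>. What is left to estimate is the
  surplus at bisections, and \<open>top\<close> receives this inequality as a premise.\<close>

lemma stability_level_ge_coupling:
  fixes J h L :: real
  assumes r: "r > 0" and J: "J > 0" and h: "h \<le> J * cheeger n E"
    and top: "\<And>A. A \<subseteq> {1..n} \<Longrightarrow> card A = n div 2 \<Longrightarrow>
      h * card A + coupling c J r 2 * card (second_cut n E A) \<le> cut_weight n E (coupling c J r) A \<Longrightarrow>
      L \<le> 2 * cut_weight n E (coupling c J r) A - 2 * h * card A"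
  shows "ereal L \<le> stability_level n (hamiltonian n E (coupling c J r) h) (all_minus n)"
proof -
  let ?K = "coupling c J r"
  have cut_ge: "h * card A + ?K 2 * card (second_cut n E A) \<le> cut_weight n E ?K A"
    if A: "A \<subseteq> {1..n}" "card A \<le> n div 2" for A
  proof -
    have "h * card A \<le> J * card (edge_boundary E A)"
    proof (cases "A = {}")
      case False
      have "h * card A \<le> J * cheeger n E * card A" using h by (rule mult_right_mono) simp
      also have "\<dots> \<le> J * card (edge_boundary E A)"
        using cheeger_le[OF A(1) False, of E] A(2) J by (simp add: mult.assoc)
      finally show ?thesis .
    qed (simp add: J less_imp_le)
    then show ?thesis
      using edge_boundary_second_cut_le[OF A(1), of ?K] coupling_nonneg[OF J] coupling_1[OF r, of c J] by force
  qed
  show ?thesis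
  proof (rule stability_level_ge[OF sym_E])
    fix A assume A: "A \<subseteq> {1..n}" "card A \<le> n div 2"
    have "0 \<le> ?K 2 * card (second_cut n E A)" using coupling_nonneg[OF J] by simp
    then show "h * card A \<le> cut_weight n E ?K A" using cut_ge[OF A] by linarith
  next
    fix A assume A: "A \<subseteq> {1..n}" "card A = n div 2"
    show "L \<le> 2 * cut_weight n E ?K A - 2 * h * card A"
      by (rule top[OF A cut_ge]) (use A in simp_all)
  qed
qed

text \<open>The coupling at distance 2 is \<open>J / r\<close>, so the pairs of
  \<open>second_cut\<close> give \<open>2 * (J / r) * (1/4 - 5 * \<epsilon>) * r ^ 2 * n\<close>,
  which is the claimed bound.\<close>

lemma stability_level_exponential_ge:
  fixes J h \<epsilon> :: real
  assumes r: "r > 0" and J: "J > 0" and h: "h \<le> J * cheeger n E"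
    and sparse: "\<not> sparse_cut r n \<epsilon> E"
  shows "ereal (J * (real r / 2 - 10 * \<epsilon> * r) * n)
    \<le> stability_level n (hamiltonian n E (coupling Exponential J r) h) (all_minus n)"
proof (rule stability_level_ge_coupling[OF r J h])
  fix A assume A: "A \<subseteq> {1..n}" "card A = n div 2"
    and cut: "h * card A + coupling Exponential J r 2 * card (second_cut n E A)
      \<le> cut_weight n E (coupling Exponential J r) A"
  have K2: "coupling Exponential J r 2 = J / r" using r by (simp add: powr_minus divide_inverse)
  have "(1/4 - 5 * \<epsilon>) * (real r)\<^sup>2 * n \<le> card (second_cut n E A)"
    using sparse A unfolding sparse_cut_def by force
  then have "J / r * ((1/4 - 5 * \<epsilon>) * (real r)\<^sup>2 * n) \<le> J / r * card (second_cut n E A)"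
    using J by (intro mult_left_mono) auto
  then have "J / r * ((1/4 - 5 * \<epsilon>) * (real r)\<^sup>2 * n) \<le> cut_weight n E (coupling Exponential J r) A - h * card A"
    using cut unfolding K2 by linarith
  then have "2 * (J / r * ((1/4 - 5 * \<epsilon>) * (real r)\<^sup>2 * n))
      \<le> 2 * (cut_weight n E (coupling Exponential J r) A - h * card A)"
    by (rule mult_left_mono) simp
  moreover have "2 * (J / r * ((1/4 - 5 * \<epsilon>) * (real r)\<^sup>2 * n)) = J * (real r / 2 - 10 * \<epsilon> * r) * n"
    using r by (simp add: field_simps power2_eq_square)
  ultimately show "J * (real r / 2 - 10 * \<epsilon> * r) * n
      \<le> 2 * cut_weight n E (coupling Exponential J r) A - 2 * h * card A"
    by (simp add: right_diff_distrib mult.assoc)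
qed

text \<open>This serves those \<open>r\<close> for which \<open>\<epsilon>\<close> exceeds
  \<open>1/12\<close> and the claimed lower bound is not positive.\<close>

lemma stability_level_nonneg:
  fixes J h :: real
  assumes r: "r > 0" and J: "J > 0" and h: "h \<le> J * cheeger n E"
  shows "0 \<le> stability_level n (hamiltonian n E (coupling c J r) h) (all_minus n)"
  unfolding zero_ereal_def
proof (rule stability_level_ge_coupling[OF r J h])
  fix A assume cut: "h * card A + coupling c J r 2 * card (second_cut n E A)
      \<le> cut_weight n E (coupling c J r) A"
  have "0 \<le> coupling c J r 2 * card (second_cut n E A)" using coupling_nonneg[OF J] by simp
  then show "0 \<le> 2 * cut_weight n E (coupling c J r) A - 2 * h * card A" using cut by linarith
qed

text \<open>The Cheeger constant is at least \<open>h / J\<close>, so the diameter is at most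
  \<open>2 * k\<close> and every pair interacts with strength at least
  \<open>J * (2 * k) powr (- l)\<close>. A bisection cuts about \<open>n ^ 2 / 4\<close> pairs;
  \<open>large\<close> says that this outweighs the field and the target.\<close>

lemma stability_level_power_law_ge:
  fixes J h l :: real
  assumes r: "r > 0" and J: "J > 0" and h: "0 < h" "h \<le> J * cheeger n E" and l: "l > 0"
    and n: "n > 0" and k: "real n < (1 + h / J / r) ^ k" "k > 0"
    and large: "J * r / 2 + h \<le> (real n - 1) / 2 * J * real (2 * k) powr (- l)"
  shows "ereal (J * (real r / 2) * n)
    \<le> stability_level n (hamiltonian n E (coupling (Power_Law l) J r) h) (all_minus n)"
proof (rule stability_level_ge_coupling[OF r J h(2)])
  let ?K = "coupling (Power_Law l) J r"
  fix A assume A: "A \<subseteq> {1..n}" "card A = n div 2"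
  have fin: "finite A" using A(1) finite_subset by auto
  define w where "w = J * real (2 * k) powr (- l)"
  have w: "w \<ge> 0" using J by (simp add: w_def)
  have "graph_diam n E \<le> 2 * k"
  proof (rule graph_diam_le_of_expansion[OF n r _ _ k(1)])
    show "0 \<le> h / J" using h J by simp
    fix B assume B: "B \<subseteq> {1..n}" "B \<noteq> {}" "2 * card B \<le> n"
    have "h / J \<le> cheeger n E" using h J by (simp add: pos_divide_le_eq mult.commute)
    then have "h / J * card B \<le> cheeger n E * card B" by (rule mult_right_mono) simp
    also have "\<dots> \<le> card (edge_boundary E B)" using B by (rule cheeger_le)
    finally show "h / J * card B \<le> card (edge_boundary E B)" .
  qed
  then have w_le: "w \<le> ?K (graph_dist E x y)" if "x \<in> {1..n}" "y \<in> {1..n}" "x \<noteq> y" for x y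
  proof -
    have "graph_dist E x y \<le> 2 * k" using \<open>graph_diam n E \<le> 2 * k\<close> graph_dist_le_diam[OF that(1,2)] by linarith
    then have d: "0 < real (graph_dist E x y)" "real (graph_dist E x y) \<le> real (2 * k)"
      using graph_dist_eq_0_iff[OF that(1,2)] that(3) by (simp, simp only: of_nat_le_iff)
    have "real (2 * k) powr (- l) \<le> real (graph_dist E x y) powr (- l)"
      using l by (intro powr_mono2' d) simp
    then show ?thesis using J by (simp add: w_def)
  qed
  have "w * (real (card A) * real (n - card A)) = (\<Sum>p\<in>A \<times> ({1..n} - A). w)"
    using A(1) fin by (simp add: card_cartesian_product card_Diff_subset)
  also have "\<dots> \<le> cut_weight n E ?K A"
    unfolding cut_weight_def
  proof (rule sum_mono)
    fix p assume p: "p \<in> A \<times> ({1..n} - A)"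
    obtain x y where xy: "p = (x, y)" by (cases p)
    have "x \<in> {1..n}" "y \<in> {1..n}" "x \<noteq> y" using p A(1) unfolding xy by auto
    then have "w \<le> ?K (graph_dist E x y)" by (rule w_le)
    then show "w \<le> (case p of (x, y) \<Rightarrow> ?K (graph_dist E x y))" unfolding xy prod.case .
  qed
  finally have cut_ge: "w * (real (card A) * real (n - card A)) \<le> cut_weight n E ?K A" .
  \<comment> \<open>For either parity the halves have at least \<open>(n - 1) / 2\<close> and
    \<open>n / 2\<close> vertices.\<close>
  have "(real n - 1) / 2 * (n / 2) \<le> real (card A) * real (n - card A)"
    using n unfolding A(2) by (intro mult_mono) auto
  then have "w * ((real n - 1) / 2 * (n / 2)) \<le> w * (real (card A) * real (n - card A))"
    using w by (rule mult_left_mono)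
  then have "w * ((real n - 1) / 2 * (n / 2)) \<le> cut_weight n E ?K A"
    using cut_ge by linarith
  moreover have "(J * r / 2 + h) * n \<le> (real n - 1) / 2 * J * real (2 * k) powr (- l) * n"
    using large by (rule mult_right_mono) simp
  moreover have "w * ((real n - 1) / 2 * (n / 2)) * 2 = (real n - 1) / 2 * J * real (2 * k) powr (- l) * n"
    by (simp add: w_def)
  moreover have "2 * h * card A \<le> h * n"
  proof -
    have "2 * real (card A) \<le> n" unfolding A(2) by auto
    then have "h * (2 * real (card A)) \<le> h * n" using h(1) by (intro mult_left_mono) auto
    then show ?thesis by simp
  qed
  moreover have "(J * r / 2 + h) * n = J * (real r / 2) * n + h * n" by (simp add: algebra_simps)
  ultimately show "J * (real r / 2) * n \<le> 2 * cut_weight n E ?K A - 2 * h * card A"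
    by linarith
qed

end

section \<open>Passage to high probability\<close>

lemma admissibleD:
  assumes "admissible r n E J h"
  shows "n > 0" "cheeger n E > 0" "h \<le> J * cheeger n E"
proof -
  have a: "int n > \<lceil>real r ^ r\<rceil>" "cheeger n E > 0" "J \<ge> of_int \<lceil>h / cheeger n E\<rceil>"
    using assms by (auto simp: admissible_def)
  have "0 \<le> real r ^ r" by simp
  then show "n > 0" using a(1) by linarith
  show "cheeger n E > 0" by fact
  have "h / cheeger n E \<le> J" using a(3) by linarith
  then show "h \<le> J * cheeger n E" using a(2) by (simp add: pos_divide_le_eq)
qed

text \<open>The hypothesis counts exceptional graphs and makes sense even where no regular graph
  exists. Division by the number of graphs takes place only for \<open>n > r\<close> with
  \<open>n * r\<close> even, where it is positive.\<close>

lemma prob_regular_graph_tendsto_1: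
  assumes \<delta>: "\<delta> \<longlonglongrightarrow> 0"
    and le: "\<forall>\<^sub>F n in sequentially. real (card {E \<in> regular_graphs r n. E \<notin> X n})
      \<le> \<delta> n * real (card (regular_graphs r n))"
  shows "((\<lambda>n. measure_pmf.prob (random_regular_graph r n) (X n)) \<longlongrightarrow> 1)
    (inf sequentially (principal {n. even (n * r)}))"
proof (rule tendsto_sandwich[where f = "\<lambda>n. 1 - \<delta> n" and h = "\<lambda>_. 1"])
  have "(\<lambda>n. 1 - \<delta> n) \<longlonglongrightarrow> 1" using tendsto_diff[OF tendsto_const[of 1] \<delta>] by simp
  then show "((\<lambda>n. 1 - \<delta> n) \<longlongrightarrow> 1) (inf sequentially (principal {n. even (n * r)}))"
    by (rule tendsto_mono[rotated]) simp
  show "\<forall>\<^sub>F n in inf sequentially (principal {n. even (n * r)}).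
      1 - \<delta> n \<le> measure_pmf.prob (random_regular_graph r n) (X n)"
    unfolding eventually_inf_principal
    using le eventually_gt_at_top[of r]
  proof eventually_elim
    case (elim n)
    show ?case
    proof
      assume "n \<in> {n. even (n * r)}"
      then have ne: "regular_graphs r n \<noteq> {}" using elim(2) by (intro regular_graphs_nonempty) auto
      let ?G = "regular_graphs r n"
      have pos: "real (card ?G) > 0" using ne finite_regular_graphs by (simp add: card_gt_0_iff)
      have "card ?G = card (?G \<inter> X n) + card {E \<in> ?G. E \<notin> X n}"
        using finite_regular_graphs by (subst card_Un_disjoint[symmetric]) (auto intro: arg_cong[where f = card])
      then have "(1 - \<delta> n) * real (card ?G) \<le> real (card (?G \<inter> X n))"
        using elim(1) by (simp add: algebra_simps)
      then show "1 - \<delta> n \<le> measure_pmf.prob (random_regular_graph r n) (X n)"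
        unfolding random_regular_graph_def measure_pmf_of_set[OF ne finite_regular_graphs]
        using pos by (simp add: pos_le_divide_eq)
    qed
  qed
qed auto

theorem proposition2p6:
  "\<exists>\<omega>\<^sub>l \<omega>\<^sub>u :: nat \<Rightarrow> real. \<omega>\<^sub>l \<in> o(\<lambda>r. real r) \<and> \<omega>\<^sub>u \<in> o(\<lambda>r. real r) \<and>
     (\<forall>(r::nat) (c::decay) (J::real) (h::real).
        r \<ge> 3 \<longrightarrow> (c = Exponential \<or> (\<exists>l>2. c = Power_Law l)) \<longrightarrow> J > 0 \<longrightarrow> h > 0 \<longrightarrow>
        ((\<lambda>n. measure_pmf.prob (random_regular_graph r n)
            {E. admissible r n E J h \<longrightarrow>
                ereal (J * (real r / 2 - \<omega>\<^sub>l r) * real n)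
                  \<le> stability_level n (hamiltonian n E (coupling c J r) h) (all_minus n) \<and>
                stability_level n (hamiltonian n E (coupling c J r) h) (all_minus n)
                  \<le> ereal (J * (real r * upper_factor c r (graph_diam n E) + \<omega>\<^sub>u r) * real n)})
          \<longlongrightarrow> 1) (inf sequentially (principal {n. even (n * r)})))"
proof (intro exI conjI allI impI)
  \<comment> \<open>\<open>\<omega> r = 10 * \<epsilon> * r\<close> for the smallest \<open>\<epsilon>\<close>, of order \<open>r powr (-1/3)\<close>, at which the union bound over
    the at most \<open>4 ^ n\<close> pairs in \<open>discrepant_le\<close> works\<close>
  define \<omega> :: "nat \<Rightarrow> real" where "\<omega> r = 30 * real r powr (2/3)" for r
  show "\<omega> \<in> o(\<lambda>r. real r)" unfolding \<omega>_def by real_asymp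
  \<comment> \<open>The geometric and zeta series already stay within the main term, so the upper
    correction can be taken as zero.\<close>
  show "(\<lambda>_. 0) \<in> o(\<lambda>r. real r)" by simp
  fix r :: nat and c :: decay and J h :: real
  assume r: "r \<ge> 3" and c: "c = Exponential \<or> (\<exists>l>2. c = Power_Law l)" and J: "J > 0" and h: "h > 0"
  define good where "good n E \<longleftrightarrow> (admissible r n E J h \<longrightarrow>
      ereal (J * (real r / 2 - \<omega> r) * real n)
        \<le> stability_level n (hamiltonian n E (coupling c J r) h) (all_minus n) \<and>
      stability_level n (hamiltonian n E (coupling c J r) h) (all_minus n)
        \<le> ereal (J * (real r * upper_factor c r (graph_diam n E) + 0) * real n))" for n E
  define \<epsilon> where "\<epsilon> = 3 * real r powr (-1/3)"
  have \<epsilon>: "\<epsilon> > 0" using r by (simp add: \<epsilon>_def)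
  \<comment> \<open>The factor 3 in \<open>\<epsilon>\<close> makes this product at least the 24
    required by \<open>sparse_cut_le\<close>.\<close>
  have \<epsilon>3: "real r * \<epsilon> ^ 3 = 27"
  proof -
    have "(real r powr (-1/3)) ^ 3 = real r powr (-1)" using r by (simp add: powr_power)
    then show ?thesis using r by (simp add: \<epsilon>_def power_mult_distrib powr_minus)
  qed
  have \<omega>\<epsilon>: "\<omega> r = 10 * \<epsilon> * r"
  proof -
    have "real r powr (2/3) = real r powr (-1/3) * real r powr 1"
      by (subst powr_add[symmetric]) simp
    then show ?thesis using r by (simp add: \<omega>_def \<epsilon>_def)
  qed
  have \<omega>0: "\<omega> r \<ge> 0" by (simp add: \<omega>_def)
  have "\<exists>\<delta>. \<delta> \<longlonglongrightarrow> 0 \<and> (\<forall>\<^sub>F n in sequentially.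
      real (card {E \<in> regular_graphs r n. E \<notin> {E. good n E}}) \<le> \<delta> n * real (card (regular_graphs r n)))"
    using c
  proof
    assume c: "c = Exponential"
    have good: "good n E" if E: "E \<in> regular_graphs r n" and sparse: "\<epsilon> \<le> 1/12 \<Longrightarrow> \<not> sparse_cut r n \<epsilon> E" for n E
      unfolding good_def
    proof (intro impI conjI)
      assume "admissible r n E J h"
      note adm = admissibleD[OF this]
      interpret connected_regular_graph r n E using E adm(2) by (rule connected_regular_graphI)
      show "ereal (J * (real r / 2 - \<omega> r) * real n)
        \<le> stability_level n (hamiltonian n E (coupling c J r) h) (all_minus n)"
      proof (cases "\<epsilon> \<le> 1/12")
        case True
        then show ?thesis
          unfolding c \<omega>\<epsilon> using r J adm(3) sparse by (intro stability_level_exponential_ge) auto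
      next
        case False
        then have "10 * (1/12) * real r \<le> 10 * \<epsilon> * r" by (intro mult_right_mono) auto
        then have "real r / 2 - \<omega> r \<le> 0" unfolding \<omega>\<epsilon> by simp
        then have "J * (real r / 2 - \<omega> r) * real n \<le> 0"
          using J by (intro mult_nonpos_nonneg mult_nonneg_nonpos) auto
        then have "ereal (J * (real r / 2 - \<omega> r) * real n) \<le> 0" by (simp add: zero_ereal_def)
        also have "0 \<le> stability_level n (hamiltonian n E (coupling c J r) h) (all_minus n)"
          using r J adm(3) by (intro stability_level_nonneg) auto
        finally show ?thesis .
      qed
      show "stability_level n (hamiltonian n E (coupling c J r) h) (all_minus n)
        \<le> ereal (J * (real r * upper_factor c r (graph_diam n E) + 0) * real n)"
        using stability_level_le_upper_factor[OF r adm(1) J h, of c] c by simp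
    qed
    show ?thesis
    proof (cases "\<epsilon> \<le> 1/12")
      case True
      \<comment> \<open>The first term bounds the discrepant graphs, the second those with many
        short cycles.\<close>
      define \<delta> where "\<delta> = (\<lambda>n. 2 * (1 / 2) ^ n +
        ((2 * real r) ^ 3 + (2 * real r) ^ 4) / (\<epsilon> * (real r)\<^sup>2 * real n))"
      have "\<delta> \<longlonglongrightarrow> 0"
      proof -
        have "(\<lambda>n. 2 * (1 / 2 :: real) ^ n) \<longlonglongrightarrow> 0"
          by (intro tendsto_mult_right_zero LIMSEQ_power_zero) simp
        moreover have "(\<lambda>n. ((2 * real r) ^ 3 + (2 * real r) ^ 4) / (\<epsilon> * (real r)\<^sup>2 * real n)) \<longlonglongrightarrow> 0"
        proof (rule tendsto_divide_0[OF tendsto_const])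
          show "filterlim (\<lambda>n. \<epsilon> * (real r)\<^sup>2 * real n) at_infinity sequentially"
            using \<epsilon> r by (intro filterlim_at_top_imp_at_infinity
              filterlim_tendsto_pos_mult_at_top[OF tendsto_const] filterlim_real_sequentially) simp
        qed
        ultimately show ?thesis unfolding \<delta>_def by (rule tendsto_add_zero)
      qed
      moreover have "\<forall>\<^sub>F n in sequentially. real (card {E \<in> regular_graphs r n. E \<notin> {E. good n E}})
          \<le> \<delta> n * real (card (regular_graphs r n))"
      proof -
        have "\<forall>\<^sub>F n in sequentially. (2 * real r + 6) / \<epsilon> \<le> real n"
          "\<forall>\<^sub>F n in sequentially. 4 * real r + 20 \<le> real n"
          using filterlim_real_sequentially by (auto simp: filterlim_at_top)
        then show ?thesis
        proof eventually_elim
          case (elim n)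
          have "card {E \<in> regular_graphs r n. E \<notin> {E. good n E}}
              \<le> card {E \<in> regular_graphs r n. sparse_cut r n \<epsilon> E}"
            using finite_regular_graphs good by (intro card_mono) auto
          also have "real \<dots> \<le> \<delta> n * real (card (regular_graphs r n))"
            unfolding \<delta>_def using r \<epsilon> True \<epsilon>3 elim
            by (intro sparse_cut_le) (auto simp: pos_divide_le_eq mult.commute)
          finally show ?case by simp
        qed
      qed
      ultimately show ?thesis by blast
    next
      case False
      then have none: "{E \<in> regular_graphs r n. E \<notin> {E. good n E}} = {}" for n using good by auto
      show ?thesis unfolding none by (intro exI[of _ "\<lambda>_. 0"]) simp
    qed
  next
    assume "\<exists>l>2. c = Power_Law l"
    then obtain l where l: "l > 2" and c: "c = Power_Law l" by auto
    \<comment> \<open>\<open>g\<close> is the guaranteed growth factor of balls. \<open>k n\<close>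
      is chosen with \<open>g ^ k n > n\<close>, and \<open>b\<close> so that the diameter bound
      \<open>2 * k n\<close> is at most \<open>b * ln n + 2\<close>.\<close>
    define g where "g = 1 + h / J / r"
    have g: "g > 1" using h J r by (simp add: g_def)
    define b where "b = 2 / ln g"
    have b: "b > 0" using g by (simp add: b_def)
    define k where "k n = nat \<lfloor>ln (real n) / ln g\<rfloor> + 1" for n :: nat
    have "filterlim (\<lambda>n. (real n - 1) / 2 * J * (b * ln (real n) + 2) powr (- l)) at_top sequentially"
      using J b l by real_asymp
    then have "\<forall>\<^sub>F n in sequentially. J * r / 2 + h \<le> (real n - 1) / 2 * J * (b * ln (real n) + 2) powr (- l)"
      unfolding filterlim_at_top by (rule spec)
    moreover have "\<forall>\<^sub>F n in sequentially. real (Suc (nat \<lceil>l\<rceil> * r ^ nat \<lceil>l\<rceil>)) < real n"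
      by (simp only: of_nat_less_iff eventually_gt_at_top)
    \<comment> \<open>For the power law the bounds are deterministic: for large \<open>n\<close> no
      regular graph is exceptional, so the error bound is zero.\<close>
    ultimately have "\<forall>\<^sub>F n in sequentially. \<forall>E\<in>regular_graphs r n. good n E"
      using eventually_gt_at_top[of 0]
    proof eventually_elim
      case (elim n)
      have n: "real n \<ge> 1" using elim(3) by simp
      have x: "0 \<le> ln (real n) / ln g" using n g by simp
      have k: "ln (real n) / ln g < real (k n)" "real (k n) \<le> ln (real n) / ln g + 1"
        using x unfolding k_def by linarith+
      have "ln (real n) < real (k n) * ln g" using k(1) g by (simp add: pos_divide_less_eq)
      also have "\<dots> = ln (g ^ k n)" using g by (simp add: ln_realpow)
      finally have kn: "real n < g ^ k n" using n g by simp
      have "2 * real (k n) \<le> b * ln (real n) + 2" using k(2) by (simp add: b_def)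
      moreover have "0 < 2 * real (k n)" by (simp add: k_def)
      ultimately have "(b * ln (real n) + 2) powr (- l) \<le> real (2 * k n) powr (- l)"
        using l by (intro powr_mono2') auto
      then have "(real n - 1) / 2 * J * (b * ln (real n) + 2) powr (- l)
          \<le> (real n - 1) / 2 * J * real (2 * k n) powr (- l)"
        using n J by (intro mult_left_mono) auto
      then have large: "J * r / 2 + h \<le> (real n - 1) / 2 * J * real (2 * k n) powr (- l)"
        using elim(1) by linarith
      show ?case
      proof
        fix E assume E: "E \<in> regular_graphs r n"
        show "good n E"
          unfolding good_def
        proof (intro impI conjI)
          assume "admissible r n E J h"
          note adm = admissibleD[OF this]
          interpret connected_regular_graph r n E using E adm(2) by (rule connected_regular_graphI)
          have "J * (real r / 2 - \<omega> r) * real n \<le> J * (real r / 2) * real n"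
            using J \<omega>0 by (intro mult_right_mono mult_left_mono) auto
          moreover have "ereal (J * (real r / 2) * n)
              \<le> stability_level n (hamiltonian n E (coupling c J r) h) (all_minus n)"
            unfolding c
            by (rule stability_level_power_law_ge[OF _ J h adm(3) _ adm(1) kn[unfolded g_def] _ large])
              (use r l in \<open>simp_all add: k_def\<close>)
          ultimately show "ereal (J * (real r / 2 - \<omega> r) * real n)
              \<le> stability_level n (hamiltonian n E (coupling c J r) h) (all_minus n)"
            by (meson ereal_less_eq(3) order_trans)
          have "l < real (graph_diam n E)" using r elim(2) by (intro graph_diam_gt) auto
          then show "stability_level n (hamiltonian n E (coupling c J r) h) (all_minus n)
              \<le> ereal (J * (real r * upper_factor c r (graph_diam n E) + 0) * real n)"
            using stability_level_le_upper_factor[OF r adm(1) J h, of c] c l by simp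
        qed
      qed
    qed
    then have "\<forall>\<^sub>F n in sequentially. real (card {E \<in> regular_graphs r n. E \<notin> {E. good n E}})
        \<le> 0 * real (card (regular_graphs r n))"
    proof eventually_elim
      case (elim n)
      then have none: "{E \<in> regular_graphs r n. E \<notin> {E. good n E}} = {}" by auto
      show ?case unfolding none by simp
    qed
    then show ?thesis by (intro exI[of _ "\<lambda>_. 0"]) simp
  qed
  then obtain \<delta> where "\<delta> \<longlonglongrightarrow> 0" "\<forall>\<^sub>F n in sequentially.
      real (card {E \<in> regular_graphs r n. E \<notin> {E. good n E}}) \<le> \<delta> n * real (card (regular_graphs r n))"
    by blast
  from prob_regular_graph_tendsto_1[OF this]
  show "((\<lambda>n. measure_pmf.prob (random_regular_graph r n)
            {E. admissible r n E J h \<longrightarrow>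
                ereal (J * (real r / 2 - \<omega> r) * real n)
                  \<le> stability_level n (hamiltonian n E (coupling c J r) h) (all_minus n) \<and>
                stability_level n (hamiltonian n E (coupling c J r) h) (all_minus n)
                  \<le> ereal (J * (real r * upper_factor c r (graph_diam n E) + 0) * real n)})
          \<longlongrightarrow> 1) (inf sequentially (principal {n. even (n * r)}))"
    unfolding good_def .
qed

end
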